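(* Let $d=3$. The ideals of line arrangements with at most $4$ lines are irreducible; that is, if $L$ is a line arrangement on $[n]$ with at most $4$ lines, then the variety $V_L=\overline{Z^o_L}\subseteq\mathbb{K}^{3\times n}$ is irreducible, equivalently its ideal $I_L$ is prime.
   Context: $\mathbb{K}$ is an algebraically closed field. Line arrangements. A line arrangement $L=(\mathcal{P},\mathcal{L},\mathcal{I})$ on $[n]=\{1,\dots,n\}$ with possibly empty set of zero points $S\subseteq[n]$ consists of a partition $\mathcal{P}$ of $[n]\setminus S$ (whose blocks are called points), a set $\mathcal{L}$ of lines, and an incidence relation $\mathcal{I}\subseteq\mathcal{P}\times\mathcal{L}$, such that each line contains at least three distinct points and any pair of points lies on at most one common line. Elements of $[n]$ are also called points of $L$; $i,j\in[n]\setminus S$ coincide if they belong to the same block. Configuration space, variety and ideal (for $d=3$). Let $X=(x_{i,j})$ be a $3\times n$ matrix of variables. For $A\subseteq[3]$, $B\subseteq[n]$ with $|A|=|B|$, $[A|B]$ is the determinant of the submatrix of $X$ with rows $A$ and columns $B$. $V(I)$ denotes the vanishing locus of an ideal $I$ in $\mathbb{K}^{3\times n}$. Let $N_L\subseteq\mathbb{K}[X]$ be the ideal generated by: all variables $x_{i,j}$ with $i\in[3]$, $j\in S$; all $2$-minors $[A|B]$ with $|A|=|B|=2$ and $B\subseteq P$ for some $P\in\mathcal{P}$; and all $3$-minors $[A|B]$ with $A=[3]$ and $B$ a triple of distinct non-zero points of $L$ lying on a common line. A basis of $L$ is a maximal subset $B\subseteq[n]$ of size at most $3$ such that $B\cap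 S=\emptyset$, no two points in $B$ coincide and no three points in $B$ lie on the same line. For a basis $B$, let $I_B=\langle[A|B]: A\subseteq[3],\ |A|=|B|\rangle$. The configuration space is $Z^o_L=V(N_L)\setminus\bigcup_B V(I_B)$, the union being over all bases $B$ of $L$; $V_L$ is its Zariski closure, and $I_L\subseteq\mathbb{K}[X]$ is the ideal of all polynomials vanishing on $Z^o_L$. *)

theory Defs
  imports
    "HOL-Algebra.Ideal"
    "HOL-Computational_Algebra.Polynomial"
    "HOL-Library.Disjoint_Sets"
    "HOL-Library.Poly_Mapping"
    "Jordan_Normal_Form.DL_Submatrix"
    "Jordan_Normal_Form.Determinant"
    "Jordan_Normal_Form.VS_Connect"
begin

text \<open>
  Rows, columns and ground-set elements are numbered from 0, as for the library's matrices:
  \<open>{..<3}\<close> plays the role of \<open>{1, 2, 3}\<close> and \<open>{..<n}\<close> that of \<open>{1, \<dots>, n}\<close>.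
\<close>

section \<open>Line arrangements\<close>

record 'l arrangement =
  zeros :: "nat set"
  blocks :: "nat set set"
  lines :: "'l set"
  incid :: "(nat set \<times> 'l) set"

definition line_arrangement :: "nat \<Rightarrow> 'l arrangement \<Rightarrow> bool" where
  "line_arrangement n L \<longleftrightarrow>
     zeros L \<subseteq> {..<n} \<and>
     partition_on ({..<n} - zeros L) (blocks L) \<and>
     incid L \<subseteq> blocks L \<times> lines L \<and>
     (\<forall>l\<in>lines L. 3 \<le> card {P. (P, l) \<in> incid L}) \<and>
     (\<forall>P\<in>blocks L. \<forall>Q\<in>blocks L. P \<noteq> Q \<longrightarrow>
        (\<forall>l l'. {(P, l), (Q, l), (P, l'), (Q, l')} \<subseteq> incid L \<longrightarrow> l = l'))"

definition coincide :: "'l arrangement \<Rightarrow> nat \<Rightarrow> nat \<Rightarrow> bool" where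
  "coincide L i j \<longleftrightarrow> (\<exists>P\<in>blocks L. i \<in> P \<and> j \<in> P)"

definition collinear :: "'l arrangement \<Rightarrow> nat set \<Rightarrow> bool" where
  "collinear L B \<longleftrightarrow> (\<exists>l\<in>lines L. \<forall>i\<in>B. \<exists>P. (P, l) \<in> incid L \<and> i \<in> P)"

definition independent :: "nat \<Rightarrow> 'l arrangement \<Rightarrow> nat set \<Rightarrow> bool" where
  "independent n L B \<longleftrightarrow>
     B \<subseteq> {..<n} \<and> card B \<le> 3 \<and> B \<inter> zeros L = {} \<and>
     (\<forall>i\<in>B. \<forall>j\<in>B. i \<noteq> j \<longrightarrow> \<not> coincide L i j) \<and>
     \<not> (\<exists>T\<subseteq>B. card T = 3 \<and> collinear L T)"

text \<open>Maximality is with respect to inclusion.\<close>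

definition is_basis :: "nat \<Rightarrow> 'l arrangement \<Rightarrow> nat set \<Rightarrow> bool" where
  "is_basis n L B \<longleftrightarrow>
     independent n L B \<and> (\<forall>B'. independent n L B' \<and> B \<subseteq> B' \<longrightarrow> B' = B)"

section \<open>The polynomial ring in the entries of a generic 3 by n matrix\<close>

text \<open>
  Polynomials are finitely supported maps from monomials to coefficients, monomials being finitely
  supported maps from variables to exponents. The variable \<open>(i, j)\<close> is the matrix entry in row \<open>i\<close>
  and column \<open>j\<close>; the ring below restricts to those with \<open>i < 3\<close> and \<open>j < n\<close>.
\<close>

type_synonym 'k mpoly = "((nat \<times> nat) \<Rightarrow>\<^sub>0 nat) \<Rightarrow>\<^sub>0 'k"

definition mvars :: "'k::zero mpoly \<Rightarrow> (nat \<times> nat) set" where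
  "mvars p = (\<Union>m\<in>Poly_Mapping.keys p. Poly_Mapping.keys m)"

definition poly_ring :: "nat \<Rightarrow> 'k::comm_ring_1 mpoly ring" where
  "poly_ring n = class_ring\<lparr>carrier := {p. mvars p \<subseteq> {..<3} \<times> {..<n}}\<rparr>"

definition var :: "nat \<Rightarrow> nat \<Rightarrow> 'k::comm_ring_1 mpoly" where
  "var i j = Poly_Mapping.single (Poly_Mapping.single (i, j) 1) 1"

definition peval :: "'k::comm_ring_1 mat \<Rightarrow> 'k mpoly \<Rightarrow> 'k" where
  "peval M p =
     (\<Sum>m\<in>Poly_Mapping.keys p. Poly_Mapping.lookup p m *
        (\<Prod>v\<in>Poly_Mapping.keys m. (M $$ v) ^ Poly_Mapping.lookup m v))"

definition generic_mat :: "nat \<Rightarrow> 'k::comm_ring_1 mpoly mat" where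
  "generic_mat n = mat 3 n (\<lambda>(i, j). var i j)"

definition minor :: "nat \<Rightarrow> nat set \<Rightarrow> nat set \<Rightarrow> 'k::comm_ring_1 mpoly" where
  "minor n A B = det (submatrix (generic_mat n) A B)"

section \<open>Vanishing loci, vanishing ideals and the Zariski topology\<close>

definition vanishing_locus :: "nat \<Rightarrow> 'k::comm_ring_1 mpoly set \<Rightarrow> 'k mat set" where
  "vanishing_locus n F = {M \<in> carrier_mat 3 n. \<forall>p\<in>F. peval M p = 0}"

definition vanishing_ideal :: "nat \<Rightarrow> 'k::comm_ring_1 mat set \<Rightarrow> 'k mpoly set" where
  "vanishing_ideal n Z = {p \<in> carrier (poly_ring n). \<forall>M\<in>Z. peval M p = 0}"

definition zariski_closed :: "nat \<Rightarrow> 'k::comm_ring_1 mat set \<Rightarrow> bool" where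
  "zariski_closed n C \<longleftrightarrow> (\<exists>I. ideal I (poly_ring n) \<and> C = vanishing_locus n I)"

definition zariski_closure :: "nat \<Rightarrow> 'k::comm_ring_1 mat set \<Rightarrow> 'k mat set" where
  "zariski_closure n Z = zariski_closed n hull Z"

definition zariski_irreducible :: "nat \<Rightarrow> 'k::comm_ring_1 mat set \<Rightarrow> bool" where
  "zariski_irreducible n V \<longleftrightarrow>
     V \<noteq> {} \<and>
     (\<forall>C D. zariski_closed n C \<and> zariski_closed n D \<and> V \<subseteq> C \<union> D \<longrightarrow> V \<subseteq> C \<or> V \<subseteq> D)"

section \<open>Configuration space, variety and ideal of a line arrangement\<close>

definition arr_generators :: "nat \<Rightarrow> 'l arrangement \<Rightarrow> 'k::comm_ring_1 mpoly set" where
  "arr_generators n L =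
     {var i j | i j. i < 3 \<and> j \<in> zeros L} \<union>
     {minor n A B | A B. A \<subseteq> {..<3} \<and> card A = 2 \<and> card B = 2 \<and> (\<exists>P\<in>blocks L. B \<subseteq> P)} \<union>
     {minor n {..<3} B | B. B \<subseteq> {..<n} - zeros L \<and> card B = 3 \<and> collinear L B}"

definition N_ideal :: "nat \<Rightarrow> 'l arrangement \<Rightarrow> 'k::comm_ring_1 mpoly set" where
  "N_ideal n L = genideal (poly_ring n) (arr_generators n L)"

text \<open>For \<open>B = {}\<close> the only generator is the empty determinant, which is 1.\<close>

definition basis_ideal :: "nat \<Rightarrow> nat set \<Rightarrow> 'k::comm_ring_1 mpoly set" where
  "basis_ideal n B = genideal (poly_ring n) {minor n A B | A. A \<subseteq> {..<3} \<and> card A = card B}"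

definition config_space :: "nat \<Rightarrow> 'l arrangement \<Rightarrow> 'k::comm_ring_1 mat set" where
  "config_space n L =
     vanishing_locus n (N_ideal n L) -
     (\<Union>B\<in>{B. is_basis n L B}. vanishing_locus n (basis_ideal n B))"

definition arr_variety :: "nat \<Rightarrow> 'l arrangement \<Rightarrow> 'k::comm_ring_1 mat set" where
  "arr_variety n L = zariski_closure n (config_space n L)"

definition arr_ideal :: "nat \<Rightarrow> 'l arrangement \<Rightarrow> 'k::comm_ring_1 mpoly set" where
  "arr_ideal n L = vanishing_ideal n (config_space n L)"

section \<open>Well-definedness\<close>

text \<open>
  \<open>genideal\<close> is the ideal generated by a set only if that set lies in the carrier of a ring.
\<close>

lemma mvars_minus: "mvars (- p) = mvars (p :: 'k::comm_ring_1 mpoly)"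
proof -
  have "Poly_Mapping.keys (- p) = Poly_Mapping.keys p"
    by (auto simp: Poly_Mapping.in_keys_iff)
  then show ?thesis
    by (simp add: mvars_def)
qed

lemma mvars_add: "mvars (p + q) \<subseteq> mvars p \<union> mvars (q :: 'k::comm_ring_1 mpoly)"
  using Poly_Mapping.keys_add[of p q] by (auto simp: mvars_def)

lemma mvars_mult: "mvars (p * q) \<subseteq> mvars p \<union> mvars (q :: 'k::comm_ring_1 mpoly)"
proof
  fix v assume "v \<in> mvars (p * q)"
  then obtain m where m: "m \<in> Poly_Mapping.keys (p * q)" "v \<in> Poly_Mapping.keys m"
    by (auto simp: mvars_def)
  then obtain a b where ab: "m = a + b" "a \<in> Poly_Mapping.keys p" "b \<in> Poly_Mapping.keys q"
    using Poly_Mapping.keys_mult[of p q] by blast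
  then have "v \<in> Poly_Mapping.keys a \<union> Poly_Mapping.keys b"
    using m(2) Poly_Mapping.keys_add[of a b] by blast
  with ab show "v \<in> mvars p \<union> mvars q"
    by (auto simp: mvars_def)
qed

lemma poly_ring_simps [simp]:
  "carrier (poly_ring n) = {p :: 'k::comm_ring_1 mpoly. mvars p \<subseteq> {..<3} \<times> {..<n}}"
  "monoid.mult (poly_ring n) = ((*) :: 'k mpoly \<Rightarrow> _)"
  "one (poly_ring n) = (1 :: 'k mpoly)"
  "zero (poly_ring n) = (0 :: 'k mpoly)"
  "add (poly_ring n) = ((+) :: 'k mpoly \<Rightarrow> _)"
  by (simp_all add: poly_ring_def)

lemma mvars_0 [simp]: "mvars 0 = {}" and mvars_1 [simp]: "mvars (1 :: 'k::comm_ring_1 mpoly) = {}"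
  by (simp_all add: mvars_def)

lemma cring_poly_ring: "cring (poly_ring n :: 'k::comm_ring_1 mpoly ring)"
proof (rule cringI)
  show "abelian_group (poly_ring n :: 'k mpoly ring)"
  proof (rule abelian_groupI)
    fix p :: "'k mpoly" assume "p \<in> carrier (poly_ring n)"
    then show "\<exists>q\<in>carrier (poly_ring n). q \<oplus>\<^bsub>poly_ring n\<^esub> p = \<zero>\<^bsub>poly_ring n\<^esub>"
      by (intro bexI[of _ "- p"]) (auto simp: mvars_minus)
  qed (use mvars_add in \<open>fastforce simp: algebra_simps\<close>)+
  show "comm_monoid (poly_ring n :: 'k mpoly ring)"
    by (rule comm_monoidI) (use mvars_mult in \<open>fastforce simp: algebra_simps\<close>)+
qed (simp add: algebra_simps)

lemma var_carrier: "i < 3 \<Longrightarrow> j < n \<Longrightarrow> (var i j :: 'k::comm_ring_1 mpoly) \<in> carrier (poly_ring n)"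
  by (simp add: var_def mvars_def)

lemma minor_carrier:
  assumes "A \<subseteq> {..<3}" "B \<subseteq> {..<n}" "card A = card B"
  shows "(minor n A B :: 'k::comm_ring_1 mpoly) \<in> carrier (poly_ring n)"
proof -
  interpret R: cring "poly_ring n :: 'k mpoly ring"
    by (rule cring_poly_ring)
  let ?C = "carrier (poly_ring n) :: 'k mpoly set"
  define M where "M = submatrix (generic_mat n :: 'k mpoly mat) A B"
  have sum_C: "sum f S \<in> ?C" if "\<And>x. x \<in> S \<Longrightarrow> f x \<in> ?C" for f and S :: "(nat \<Rightarrow> nat) set"
    using that
  proof (induction S rule: infinite_finite_induct)
    case (insert x S)
    then show ?case using R.a_closed[of "f x" "sum f S"] by simp
  qed simp_all
  have prod_C: "prod f S \<in> ?C" if "\<And>x. x \<in> S \<Longrightarrow> f x \<in> ?C" for f and S :: "nat set"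
    using that
  proof (induction S rule: infinite_finite_induct)
    case (insert x S)
    then show ?case using R.m_closed[of "f x" "prod f S"] by simp
  qed simp_all
  have A: "{i. i < 3 \<and> i \<in> A} = A" and B: "{j. j < n \<and> j \<in> B} = B"
    using assms by auto
  have dim: "dim_row M = card A" "dim_col M = card B"
    by (simp_all add: M_def dim_submatrix generic_mat_def A B)
  have ent: "M $$ (i, j) \<in> ?C" if "i < card A" "j < card B" for i j
  proof -
    have "pick A i \<in> A" "pick B j \<in> B"
      using that by (simp_all add: pick_in_set_le)
    then have "pick A i < 3" "pick B j < n"
      using assms by auto
    moreover have "M $$ (i, j) = generic_mat n $$ (pick A i, pick B j)"
      unfolding M_def by (rule submatrix_index) (use that in \<open>simp_all add: generic_mat_def A B\<close>)
    ultimately show ?thesis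
      using var_carrier[where 'k='k] by (simp add: generic_mat_def)
  qed
  have "det M = (\<Sum>p\<in>{p. p permutes {0..<card A}}.
                  signof p * (\<Prod>i = 0..<card A. M $$ (i, p i)))"
    using dim assms(3) by (simp add: det_def)
  also have "\<dots> \<in> ?C"
  proof (rule sum_C)
    fix p assume "p \<in> {p. p permutes {0..<card A}}"
    then have p: "p permutes {0..<card A}" by simp
    have "(\<Prod>i = 0..<card A. M $$ (i, p i)) \<in> ?C"
    proof (rule prod_C)
      fix i assume "i \<in> {0..<card A}"
      then show "M $$ (i, p i) \<in> ?C"
        using ent[of i "p i"] permutes_in_image[OF p, of i] assms(3) by simp
    qed
    then show "signof p * (\<Prod>i = 0..<card A. M $$ (i, p i)) \<in> ?C"
      by (auto simp: sign_def mvars_minus)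
  qed
  finally show ?thesis
    by (simp add: minor_def M_def)
qed

lemma arr_generators_carrier:
  assumes "line_arrangement n L"
  shows "(arr_generators n L :: 'k::comm_ring_1 mpoly set) \<subseteq> carrier (poly_ring n)"
proof -
  have P: "P \<subseteq> {..<n}" if "P \<in> blocks L" for P
    using assms that by (auto simp: line_arrangement_def partition_on_def)
  have Z: "zeros L \<subseteq> {..<n}"
    using assms by (simp add: line_arrangement_def)
  show ?thesis
    unfolding arr_generators_def
  proof (intro Un_least subsetI, goal_cases)
    case (1 x)
    then show ?case using Z var_carrier[where 'k='k] by blast
  next
    case (2 x)
    then show ?case using P minor_carrier[where 'k='k] by (smt (verit) mem_Collect_eq order_trans)
  next
    case (3 x)
    then show ?case using minor_carrier[of "{..<3}" _ n, where 'k='k]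
      by (smt (verit) Diff_subset card_lessThan mem_Collect_eq order_refl order_trans)
  qed
qed

lemma ideal_N_ideal:
  "line_arrangement n L \<Longrightarrow> ideal (N_ideal n L :: 'k::comm_ring_1 mpoly set) (poly_ring n)"
  unfolding N_ideal_def
  by (intro ring.genideal_ideal cring.axioms(1) cring_poly_ring arr_generators_carrier)

lemma ideal_basis_ideal:
  assumes "is_basis n L B"
  shows "ideal (basis_ideal n B :: 'k::comm_ring_1 mpoly set) (poly_ring n)"
  unfolding basis_ideal_def
proof (intro ring.genideal_ideal cring.axioms(1) cring_poly_ring subsetI)
  fix x :: "'k mpoly"
  assume "x \<in> {minor n A B | A. A \<subseteq> {..<3} \<and> card A = card B}"
  moreover have "B \<subseteq> {..<n}"
    using assms by (simp add: is_basis_def independent_def)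
  ultimately show "x \<in> carrier (poly_ring n)"
    using minor_carrier[where 'k='k] by blast
qed

end

theory Submission
  imports Defs
begin

text \<open>
  With at most four lines at most one point lies on three or more lines. Hence the configurations
  can be parametrised polynomially: choose that point \<open>p\<close>, take the equation of a line through it
  to be \<open>p \<times> u\<close> and of any other line to be an arbitrary vector; a point on two lines is the cross
  product of their equations, a point on one line \<open>h\<close> is \<open>h \<times> u\<close>, the remaining points are arbitrary,
  and every column is a multiple of its point. All relations of the arrangement then hold
  identically, every configuration arises, and each basis is independent for some parameter.
  Irreducibility follows as for affine space: join the parameters of two configurations by a line
  and use that a nonzero univariate polynomial has finitely many roots.
\<close>

section \<open>Evaluation of polynomials and vanishing loci\<close>

text \<open>The difficulty is to parametrise without division. A point on three lines imposes a
  determinantal condition on their equations; \<open>p \<times> u\<close> solves it polynomially,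
  because over a field the vectors orthogonal to a nonzero p are exactly the cross products with p.
  Two such points would constrain the equation of a common line twice, and the bound on the lines
  excludes this. The parameter space is a full affine space, so degenerate parameters occur and the
  relations must survive them: a line whose equation vanishes kills every point on it except
  possibly the centre, and any three of its points then either include a zero column or lie in a
  single block. What remains is a finite list of open conditions, one for each basis. Nonempty open
  sets of an affine space meet, so each condition may be verified at a parameter of its own. The
  bound returns here: three points, each on at least two lines and no two sharing a line, would need
  six lines, so either one point can be moved or two points share a line.\<close>

lemma infinite_alg_closed_field: "infinite (UNIV :: 'k::alg_closed_field set)"
proof
  assume fin: "finite (UNIV :: 'k set)"
  \<comment> \<open>Over a finite field the product vanishes everywhere, so this polynomial of
    positive degree is constantly 1 as a function and has no root.\<close>
  define p :: "'k poly" where "p = 1 + (\<Prod>a\<in>UNIV. [:- a, 1:])"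
  have ev: "poly p x = 1" for x
    using fin by (auto simp: p_def poly_prod intro!: prod_zero)
  have d: "degree (\<Prod>a\<in>UNIV. [:- a, 1:] :: 'k poly) = card (UNIV :: 'k set)"
    by (subst degree_prod_sum_eq) auto
  have "card (UNIV :: 'k set) > 0"
    using fin by (simp add: card_gt_0_iff)
  then have "degree p > 0"
    unfolding p_def by (subst degree_add_eq_right) (simp_all add: d)
  then show False
    using alg_closed_imp_poly_has_root[of p] ev by auto
qed

section \<open>Evaluation at a matrix as a ring homomorphism\<close>

definition mono_eval :: "'k::comm_ring_1 mat \<Rightarrow> ((nat \<times> nat) \<Rightarrow>\<^sub>0 nat) \<Rightarrow> 'k" where
  "mono_eval M m = (\<Prod>v\<in>Poly_Mapping.keys m. (M $$ v) ^ Poly_Mapping.lookup m v)"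

lemma mono_eval_superset:
  assumes "finite V" "Poly_Mapping.keys m \<subseteq> V"
  shows "mono_eval M m = (\<Prod>v\<in>V. (M $$ v) ^ Poly_Mapping.lookup m v)"
  unfolding mono_eval_def
  by (rule prod.mono_neutral_left) (use assms in \<open>auto simp: in_keys_iff\<close>)

lemma mono_eval_add: "mono_eval M (a + b) = mono_eval M a * mono_eval M b"
proof -
  let ?V = "Poly_Mapping.keys a \<union> Poly_Mapping.keys b"
  have "Poly_Mapping.keys (a + b) \<subseteq> ?V"
    by (rule Poly_Mapping.keys_add)
  then show ?thesis
    by (simp add: mono_eval_superset[of ?V] lookup_add power_add prod.distrib)
qed

text \<open>Cancellation can shrink the support of a sum. Over a common finite superset of the
  supports additivity becomes a termwise identity.\<close>

lemma peval_superset: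
  assumes "finite K" "Poly_Mapping.keys p \<subseteq> K"
  shows "peval M p = (\<Sum>m\<in>K. Poly_Mapping.lookup p m * mono_eval M m)"
  unfolding peval_def mono_eval_def
  by (rule sum.mono_neutral_left) (use assms in \<open>auto simp: in_keys_iff\<close>)

lemma peval_0 [simp]: "peval M 0 = 0"
  by (simp add: peval_def)

lemma peval_add: "peval M (p + q) = peval M p + peval M q"
proof -
  let ?K = "Poly_Mapping.keys p \<union> Poly_Mapping.keys q"
  have "Poly_Mapping.keys (p + q) \<subseteq> ?K"
    by (rule Poly_Mapping.keys_add)
  then show ?thesis
    by (simp add: peval_superset[of ?K] lookup_add distrib_right sum.distrib)
qed

lemma peval_sum: "peval M (sum f A) = (\<Sum>a\<in>A. peval M (f a))"
  by (induction A rule: infinite_finite_induct) (simp_all add: peval_add)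

lemma peval_single: "peval M (Poly_Mapping.single m c) = c * mono_eval M m"
  by (subst peval_superset[of "{m}"]) simp_all

lemma peval_1 [simp]: "peval M 1 = 1"
  using peval_single[of M 0 1] by (simp add: mono_eval_def)

lemma peval_var: "peval M (var i j) = M $$ (i, j)"
  by (simp add: var_def peval_single mono_eval_def)

lemma poly_mapping_eq_sum_single:
  "p = (\<Sum>m\<in>Poly_Mapping.keys p. Poly_Mapping.single m (Poly_Mapping.lookup p m))"
  by (rule poly_mapping_eqI) (auto simp: lookup_sum lookup_single when_def in_keys_iff)

lemma peval_mult: "peval M (p * q) = peval M p * peval M q"
proof -
  have "p * q = (\<Sum>a\<in>Poly_Mapping.keys p. \<Sum>b\<in>Poly_Mapping.keys q.
      Poly_Mapping.single (a + b) (Poly_Mapping.lookup p a * Poly_Mapping.lookup q b))"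
    by (subst poly_mapping_eq_sum_single[of p], subst poly_mapping_eq_sum_single[of q])
      (simp add: sum_product mult_single)
  then have "peval M (p * q) = (\<Sum>a\<in>Poly_Mapping.keys p. \<Sum>b\<in>Poly_Mapping.keys q.
      (Poly_Mapping.lookup p a * mono_eval M a) * (Poly_Mapping.lookup q b * mono_eval M b))"
    by (simp add: peval_sum peval_single mono_eval_add mult_ac)
  also have "\<dots> = peval M p * peval M q"
    by (simp add: peval_superset[OF finite_keys order_refl] sum_product)
  finally show ?thesis .
qed

lemma comm_ring_hom_peval: "comm_ring_hom (peval M)"
  by unfold_locales (simp_all add: peval_add peval_mult)

text \<open>Ring homomorphisms commute with determinants, so only the entries of the submatrix have
  to be compared.\<close>

lemma peval_minor:
  assumes M: "M \<in> carrier_mat 3 n"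
  shows "peval M (minor n A B) = det (submatrix M A B)"
proof -
  interpret comm_ring_hom "peval M"
    by (rule comm_ring_hom_peval)
  have "map_mat (peval M) (submatrix (generic_mat n) A B) = submatrix M A B"
  proof (rule eq_matI, goal_cases)
    case (1 i j)
    then have i: "i < card {i. i < 3 \<and> i \<in> A}" and j: "j < card {j. j < n \<and> j \<in> B}"
      using M by (simp_all add: dim_submatrix)
    then have "pick A i < 3" "pick B j < n"
      using pick_le by blast+
    then show ?case
      using M i j by (simp add: submatrix_def generic_mat_def peval_var)
  qed (use M in \<open>simp_all add: dim_submatrix generic_mat_def\<close>)
  then show ?thesis
    unfolding minor_def hom_det[symmetric] by simp
qed

section \<open>Vanishing ideals and loci of generated ideals\<close>

lemma ideal_vanishing_ideal:
  "ideal (vanishing_ideal n Z :: 'k::comm_ring_1 mpoly set) (poly_ring n)"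
proof -
  interpret R: cring "poly_ring n :: 'k mpoly ring"
    by (rule cring_poly_ring)
  show ?thesis
  proof (rule idealI[OF R.ring_axioms])
    show "subgroup (vanishing_ideal n Z) (add_monoid (poly_ring n :: 'k mpoly ring))"
    proof (rule subgroup.intro, goal_cases)
      case (4 x)
      have "\<ominus>\<^bsub>poly_ring n\<^esub> x = - x"
        using 4 by (intro R.minus_equality) (auto simp: mvars_minus vanishing_ideal_def)
      moreover have "peval M (- x) = 0" if "M \<in> Z" for M
        using 4 that peval_add[of M x "- x"] by (simp add: vanishing_ideal_def)
      ultimately show ?case
        using 4 by (auto simp: mvars_minus vanishing_ideal_def a_inv_def)
    qed (use mvars_add in \<open>fastforce simp: peval_add vanishing_ideal_def\<close>)+
  qed (use mvars_mult in \<open>fastforce simp: peval_mult vanishing_ideal_def\<close>)+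
qed

text \<open>The polynomials vanishing at one matrix form an ideal; once it contains the generators,
  it contains the ideal that they generate.\<close>

lemma locus_genideal:
  assumes F: "F \<subseteq> carrier (poly_ring n :: 'k::comm_ring_1 mpoly ring)"
  shows "vanishing_locus n (genideal (poly_ring n) F) = vanishing_locus n (F :: 'k mpoly set)"
proof -
  interpret R: cring "poly_ring n :: 'k mpoly ring"
    by (rule cring_poly_ring)
  have "genideal (poly_ring n) F \<subseteq> vanishing_ideal n {M}" if "\<forall>q\<in>F. peval M q = 0" for M :: "'k mat"
    by (rule R.genideal_minimal[OF ideal_vanishing_ideal])
      (use F that in \<open>auto simp: vanishing_ideal_def\<close>)
  then show ?thesis
    using R.genideal_self[OF F] by (force simp: vanishing_locus_def vanishing_ideal_def)
qed

text \<open>Both conclusions are the same statement about functions on \<open>Z\<close>: a product of polynomials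
  vanishes on \<open>Z\<close> only if a factor does.\<close>

lemma irreducible_and_prime:
  fixes Z :: "'k::field mat set"
  assumes ne: "Z \<noteq> {}"
    and prime: "\<And>f g M M'. \<lbrakk>f \<in> carrier (poly_ring n); g \<in> carrier (poly_ring n);
      M \<in> Z; M' \<in> Z; peval M f \<noteq> 0; peval M' g \<noteq> 0\<rbrakk> \<Longrightarrow> \<exists>N\<in>Z. peval N f \<noteq> 0 \<and> peval N g \<noteq> 0"
  shows "zariski_irreducible n (zariski_closure n Z) \<and>
    primeideal (vanishing_ideal n Z) (poly_ring n)"
proof
  have sub: "I \<subseteq> carrier (poly_ring n)" if "ideal I (poly_ring n)" for I :: "'k mpoly set"
    using ideal.Icarr[OF that] by blast
  show "zariski_irreducible n (zariski_closure n Z)"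
    unfolding zariski_irreducible_def
  proof (intro conjI allI impI)
    show "zariski_closure n Z \<noteq> {}"
      using ne hull_subset[of Z "zariski_closed n"] by (auto simp: zariski_closure_def)
  next
    fix C D :: "'k mat set"
    assume *: "zariski_closed n C \<and> zariski_closed n D \<and> zariski_closure n Z \<subseteq> C \<union> D"
    then obtain I J where I: "ideal I (poly_ring n)" "C = vanishing_locus n I"
      and J: "ideal J (poly_ring n)" "D = vanishing_locus n J"
      by (auto simp: zariski_closed_def)
    have Z: "Z \<subseteq> C \<union> D"
      using * hull_subset[of Z "zariski_closed n"] by (auto simp: zariski_closure_def)
    then have carr: "M \<in> carrier_mat 3 n" if "M \<in> Z" for M
      using that I J by (auto simp: vanishing_locus_def)
    have "Z \<subseteq> C \<or> Z \<subseteq> D"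
    proof (rule ccontr)
      assume "\<not> ?thesis"
      then obtain M M' f g where "M \<in> Z" "f \<in> I" "peval M f \<noteq> 0" "M' \<in> Z" "g \<in> J" "peval M' g \<noteq> 0"
        using I J carr by (auto simp: vanishing_locus_def)
      then obtain N where "N \<in> Z" "peval N f \<noteq> 0" "peval N g \<noteq> 0"
        using prime[of f g M M'] sub[OF I(1)] sub[OF J(1)] by blast
      then show False
        using Z \<open>f \<in> I\<close> \<open>g \<in> J\<close> I J by (auto simp: vanishing_locus_def)
    qed
    then show "zariski_closure n Z \<subseteq> C \<or> zariski_closure n Z \<subseteq> D"
      using * unfolding zariski_closure_def by (meson hull_minimal)
  qed
  show "primeideal (vanishing_ideal n Z) (poly_ring n)"
  proof (rule primeidealI)
    show "ideal (vanishing_ideal n Z) (poly_ring n)"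
      by (rule ideal_vanishing_ideal)
    show "cring (poly_ring n :: 'k mpoly ring)"
      by (rule cring_poly_ring)
    have "1 \<notin> vanishing_ideal n Z" "(1 :: 'k mpoly) \<in> carrier (poly_ring n)"
      using ne by (auto simp: vanishing_ideal_def)
    then show "carrier (poly_ring n) \<noteq> vanishing_ideal n Z"
      by blast
  next
    fix f g :: "'k mpoly"
    assume "f \<in> carrier (poly_ring n)" "g \<in> carrier (poly_ring n)"
      "f \<otimes>\<^bsub>poly_ring n\<^esub> g \<in> vanishing_ideal n Z"
    then show "f \<in> vanishing_ideal n Z \<or> g \<in> vanishing_ideal n Z"
      using prime[of f g] by (simp add: vanishing_ideal_def peval_mult) blast
  qed
qed

section \<open>Generic parameters\<close>

text \<open>Substitute for multivariate polynomials: the restriction to every affine line is a univariate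
  polynomial.\<close>

definition linepoly :: "(('i \<Rightarrow> 'k::comm_ring_1) \<Rightarrow> 'k) \<Rightarrow> bool" where
  "linepoly F \<longleftrightarrow> (\<forall>x y. \<exists>q. \<forall>t. F (\<lambda>i. (1 - t) * x i + t * y i) = poly q t)"

lemma linepoly_const: "linepoly (\<lambda>x. c)"
  unfolding linepoly_def by (intro allI exI[of _ "[:c:]"]) simp

lemma linepoly_coord: "linepoly (\<lambda>x. x i)"
  unfolding linepoly_def
proof (intro allI)
  fix x y :: "'a \<Rightarrow> 'b"
  show "\<exists>q. \<forall>t. (1 - t) * x i + t * y i = poly q t"
    by (rule exI[of _ "[:x i, y i - x i:]"]) (simp add: algebra_simps)
qed

lemma linepoly_add: "linepoly F \<Longrightarrow> linepoly G \<Longrightarrow> linepoly (\<lambda>x. F x + G x)"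
  unfolding linepoly_def by (metis poly_add)

lemma linepoly_diff: "linepoly F \<Longrightarrow> linepoly G \<Longrightarrow> linepoly (\<lambda>x. F x - G x)"
  unfolding linepoly_def by (metis poly_diff)

lemma linepoly_mult: "linepoly F \<Longrightarrow> linepoly G \<Longrightarrow> linepoly (\<lambda>x. F x * G x)"
  unfolding linepoly_def by (metis poly_mult)

lemma linepoly_sum: "(\<And>a. a \<in> A \<Longrightarrow> linepoly (F a)) \<Longrightarrow> linepoly (\<lambda>x. \<Sum>a\<in>A. F a x)"
  by (induction A rule: infinite_finite_induct) (simp_all add: linepoly_const linepoly_add)

lemma linepoly_prod: "(\<And>a. a \<in> A \<Longrightarrow> linepoly (F a)) \<Longrightarrow> linepoly (\<lambda>x. \<Prod>a\<in>A. F a x)"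
  by (induction A rule: infinite_finite_induct) (simp_all add: linepoly_const linepoly_mult)

lemma linepoly_power: "linepoly F \<Longrightarrow> linepoly (\<lambda>x. F x ^ n)"
  by (induction n) (simp_all add: linepoly_const linepoly_mult)

lemma linepoly_common_nonzero:
  fixes F G :: "('i \<Rightarrow> 'k::alg_closed_field) \<Rightarrow> 'k"
  assumes "linepoly F" "linepoly G" "F x \<noteq> 0" "G y \<noteq> 0"
  shows "\<exists>z. F z \<noteq> 0 \<and> G z \<noteq> 0"
proof -
  let ?z = "\<lambda>t i. (1 - t) * x i + t * y i"
  obtain p q where p: "\<And>t. F (?z t) = poly p t" and q: "\<And>t. G (?z t) = poly q t"
    using assms(1,2) unfolding linepoly_def by meson
  \<comment> \<open>The line passes through \<open>x\<close> at parameter 0 and through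
    \<open>y\<close> at parameter 1.\<close>
  have "p \<noteq> 0" "q \<noteq> 0"
    using p[of 0] q[of 1] assms(3,4) by auto
  then have "finite ({t. poly p t = 0} \<union> {t. poly q t = 0})"
    by (simp add: poly_roots_finite)
  then obtain t where "t \<notin> {t. poly p t = 0} \<union> {t. poly q t = 0}"
    using infinite_alg_closed_field ex_new_if_finite by blast
  then show ?thesis
    using p[of t] q[of t] by (intro exI[of _ "?z t"]) simp
qed

text \<open>Says that \<open>Q\<close> contains a nonempty principal open set. Keeping one function
  \<open>F\<close> as witness lets intersections be formed by multiplication.\<close>

definition generically :: "(('i \<Rightarrow> 'k::comm_ring_1) \<Rightarrow> bool) \<Rightarrow> bool" where
  "generically Q \<longleftrightarrow> (\<exists>F. linepoly F \<and> (\<exists>x. F x \<noteq> 0) \<and> (\<forall>x. F x \<noteq> 0 \<longrightarrow> Q x))"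

lemma generically_ex: "generically Q \<Longrightarrow> \<exists>x. Q x"
  unfolding generically_def by blast

lemma generically_nonzero: "linepoly F \<Longrightarrow> F x \<noteq> 0 \<Longrightarrow> generically (\<lambda>x. F x \<noteq> 0)"
  unfolding generically_def by blast

lemma generically_mono: "generically Q \<Longrightarrow> (\<And>x. Q x \<Longrightarrow> R x) \<Longrightarrow> generically R"
  unfolding generically_def by blast

text \<open>Irreducibility of the parameter space: two nonempty principal open sets meet, and the
  product of their witnesses describes the intersection.\<close>

lemma generically_conj:
  fixes Q R :: "('i \<Rightarrow> 'k::alg_closed_field) \<Rightarrow> bool"
  assumes "generically Q" "generically R"
  shows "generically (\<lambda>x. Q x \<and> R x)"
proof -
  obtain F x G y where F: "linepoly F" "F x \<noteq> 0" "\<forall>x. F x \<noteq> 0 \<longrightarrow> Q x"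
    and G: "linepoly G" "G y \<noteq> 0" "\<forall>x. G x \<noteq> 0 \<longrightarrow> R x"
    using assms unfolding generically_def by blast
  obtain z where "F z \<noteq> 0" "G z \<noteq> 0"
    using linepoly_common_nonzero[of F G x y] F G by blast
  then show ?thesis
    unfolding generically_def using linepoly_mult[OF F(1) G(1)] F(3) G(3)
    by (intro exI[of _ "\<lambda>x. F x * G x"]) auto
qed

lemma generically_ball:
  fixes Q :: "'a \<Rightarrow> ('i \<Rightarrow> 'k::alg_closed_field) \<Rightarrow> bool"
  assumes "finite A" "\<And>a. a \<in> A \<Longrightarrow> generically (Q a)"
  shows "generically (\<lambda>x. \<forall>a\<in>A. Q a x)"
  using assms
proof (induction A)
  case empty
  then show ?case
    unfolding generically_def by (intro exI[of _ "\<lambda>x. 1"]) (simp add: linepoly_const)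
next
  case (insert a A)
  then show ?case
    using generically_conj[of "Q a" "\<lambda>x. \<forall>a\<in>A. Q a x"] by simp
qed

section \<open>Cross products over a field\<close>

fun vcross :: "'k::comm_ring_1 \<times> 'k \<times> 'k \<Rightarrow> 'k \<times> 'k \<times> 'k \<Rightarrow> 'k \<times> 'k \<times> 'k" where
  "vcross (a, b, c) (d, e, f) = (b * f - c * e, c * d - a * f, a * e - b * d)"

fun vdot :: "'k::comm_ring_1 \<times> 'k \<times> 'k \<Rightarrow> 'k \<times> 'k \<times> 'k \<Rightarrow> 'k" where
  "vdot (a, b, c) (d, e, f) = a * d + b * e + c * f"

fun vscale :: "'k::comm_ring_1 \<Rightarrow> 'k \<times> 'k \<times> 'k \<Rightarrow> 'k \<times> 'k \<times> 'k" where
  "vscale s (a, b, c) = (s * a, s * b, s * c)"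

definition vdet :: "'k::comm_ring_1 \<times> 'k \<times> 'k \<Rightarrow> 'k \<times> 'k \<times> 'k \<Rightarrow> 'k \<times> 'k \<times> 'k \<Rightarrow> 'k" where
  "vdet u v w = vdot u (vcross v w)"

abbreviation vzero :: "'k::comm_ring_1 \<times> 'k \<times> 'k" where "vzero \<equiv> (0, 0, 0)"

lemma vdot_commute: "vdot u v = vdot v u"
  by (cases u; cases v) (simp add: mult_ac)

lemma vdot_vcross: "vdot u (vcross u v) = 0" "vdot v (vcross u v) = 0"
  by (cases u; cases v; simp add: algebra_simps)+

lemma vcross_zero [simp]: "vcross vzero v = vzero" "vcross v vzero = vzero"
  by (cases v; simp)+

lemma vdot_zero [simp]: "vdot vzero v = 0" "vdot v vzero = 0"
  by (cases v; simp)+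

lemma vdet_rotate: "vdet u v w = vdet v w u"
  by (cases u; cases v; cases w) (simp add: vdet_def algebra_simps)

lemma vdet_swap: "vdet v u w = - vdet u v w"
  by (cases u; cases v; cases w) (simp add: vdet_def algebra_simps)

lemma vdet_triple: "vdet u v w = vdot (vcross u v) w"
  by (cases u; cases v; cases w) (simp add: vdet_def algebra_simps)

lemma vcross_swap_eq_zero: "vcross u v = vzero \<longleftrightarrow> vcross v u = vzero"
  by (cases u; cases v) (simp add: algebra_simps, metis)

lemma vcross_vscale: "vcross (vscale s u) (vscale t v) = vscale (s * t) (vcross u v)"
  by (cases u; cases v) (simp add: algebra_simps)

lemma vdot_vscale: "vdot h (vscale s u) = s * vdot h u"
  by (cases u; cases h) (simp add: algebra_simps)

lemma vcross_self [simp]: "vcross u u = vzero"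
  by (cases u) simp

text \<open>The equation \<open>h = vcross p u\<close> determines \<open>u\<close> up to multiples
  of \<open>p\<close>. Hence the coordinate of \<open>u\<close> at a nonzero entry of
  \<open>p\<close> can be normalised to 0; two of the equations then give the other coordinates, and
  orthogonality is the third. This recovers parameters from a given configuration.\<close>

lemma nonzero_ortho_is_vcross:
  fixes p :: "'k::field \<times> 'k \<times> 'k"
  assumes "p \<noteq> vzero" "vdot p h = 0"
  shows "\<exists>u. h = vcross p u"
proof -
  obtain a b c d e f where p: "p = (a, b, c)" and h: "h = (d, e, f)"
    by (cases p; cases h) blast
  have s: "a * d + b * e + c * f = 0"
    using assms(2) p h by simp
  consider "a \<noteq> 0" | "b \<noteq> 0" | "c \<noteq> 0"
    using assms(1) p by auto
  then show ?thesis
  proof cases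
    case 1
    moreover have "a * d = - (b * e + c * f)"
      using s by (subst eq_neg_iff_add_eq_0) (simp add: ac_simps)
    ultimately have "d = - (b * e + c * f) / a"
      by (simp add: eq_divide_eq mult.commute)
    also have "\<dots> = b * (- e / a) - c * (f / a)"
      by (simp add: diff_divide_distrib add_divide_distrib)
    finally have "d = b * (- e / a) - c * (f / a)" .
    then have "h = vcross p (0, f / a, - e / a)"
      using \<open>a \<noteq> 0\<close> p h by simp
    then show ?thesis ..
  next
    case 2
    moreover have "b * e = - (a * d + c * f)"
      using s by (subst eq_neg_iff_add_eq_0) (simp add: ac_simps)
    ultimately have "e = - (a * d + c * f) / b"
      by (simp add: eq_divide_eq mult.commute)
    also have "\<dots> = c * (- f / b) - a * (d / b)"
      by (simp add: diff_divide_distrib add_divide_distrib)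
    finally have "e = c * (- f / b) - a * (d / b)" .
    then have "h = vcross p (- f / b, 0, d / b)"
      using \<open>b \<noteq> 0\<close> p h by simp
    then show ?thesis ..
  next
    case 3
    moreover have "c * f = - (a * d + b * e)"
      using s by (subst eq_neg_iff_add_eq_0) (simp add: ac_simps)
    ultimately have "f = - (a * d + b * e) / c"
      by (simp add: eq_divide_eq mult.commute)
    also have "\<dots> = a * (- d / c) - b * (e / c)"
      by (simp add: diff_divide_distrib add_divide_distrib)
    finally have "f = a * (- d / c) - b * (e / c)" .
    then have "h = vcross p (e / c, - d / c, 0)"
      using \<open>c \<noteq> 0\<close> p h by simp
    then show ?thesis ..
  qed
qed

lemma vcross_zero_imp_vscale:
  fixes w :: "'k::field \<times> 'k \<times> 'k"
  assumes "w \<noteq> vzero" "vcross w v = vzero"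
  shows "\<exists>s. v = vscale s w"
proof -
  obtain a b c d e f where p: "w = (a, b, c)" and h: "v = (d, e, f)"
    by (cases w; cases v) blast
  have s: "b * f = c * e" "c * d = a * f" "a * e = b * d"
    using assms(2) p h by simp_all
  consider "a \<noteq> 0" | "b \<noteq> 0" | "c \<noteq> 0"
    using assms(1) p by auto
  then show ?thesis
  proof cases
    case 1
    then have "v = vscale (d / a) w"
      using s p h by (simp add: field_simps)
    then show ?thesis ..
  next
    case 2
    then have "v = vscale (e / b) w"
      using s p h by (simp add: field_simps)
    then show ?thesis ..
  next
    case 3
    then have "v = vscale (f / c) w"
      using s p h by (simp add: field_simps)
    then show ?thesis ..
  qed
qed

lemma vcross_vcross_ortho:
  assumes "vdot h v = 0" "vdot m v = 0"
  shows "vcross (vcross h m) v = vzero"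
proof -
  obtain a b c d e f where "h = (a, b, c)" "m = (d, e, f)"
    by (cases h; cases m) blast
  \<comment> \<open>The expansion of the triple cross product: \<open>vdot h v\<close> times
    \<open>m\<close> minus \<open>vdot m v\<close> times \<open>h\<close>.\<close>
  then have "vcross (vcross h m) v = (d * vdot h v - a * vdot m v,
      e * vdot h v - b * vdot m v, f * vdot h v - c * vdot m v)"
    by (cases v) (simp add: algebra_simps)
  then show ?thesis
    using assms by simp
qed

text \<open>Cramer's rule: each coordinate of \<open>h\<close> times the determinant is a
  combination of the three dot products, with 2-minors as coefficients.\<close>

lemma ortho_triple_vdet:
  fixes h :: "'k::idom \<times> 'k \<times> 'k"
  assumes "h \<noteq> vzero" "vdot h u = 0" "vdot h v = 0" "vdot h w = 0"
  shows "vdet u v w = 0"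
proof -
  obtain a b c u1 u2 u3 v1 v2 v3 w1 w2 w3 where
    e: "h = (a, b, c)" "u = (u1, u2, u3)" "v = (v1, v2, v3)" "w = (w1, w2, w3)"
    by (cases h; cases u; cases v; cases w) blast
  have "a * vdet u v w = vdot h u * (v2 * w3 - v3 * w2) - vdot h v * (u2 * w3 - u3 * w2)
      + vdot h w * (u2 * v3 - u3 * v2)"
    "b * vdet u v w = vdot h u * (v3 * w1 - v1 * w3) - vdot h v * (u3 * w1 - u1 * w3)
      + vdot h w * (u3 * v1 - u1 * v3)"
    "c * vdet u v w = vdot h u * (v1 * w2 - v2 * w1) - vdot h v * (u1 * w2 - u2 * w1)
      + vdot h w * (u1 * v2 - u2 * v1)"
    unfolding e vdet_def by (simp_all add: algebra_simps)
  then have "a * vdet u v w = 0" "b * vdet u v w = 0" "c * vdet u v w = 0"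
    using assms(2-4) by simp_all
  then show ?thesis
    using assms(1) e(1) by auto
qed

lemma vdot_all_zero: "(\<And>u. vdot a u = 0) \<Longrightarrow> a = vzero"
proof -
  assume *: "\<And>u. vdot a u = 0"
  show ?thesis
    using *[of "(1, 0, 0)"] *[of "(0, 1, 0)"] *[of "(0, 0, 1)"] by (cases a) simp
qed

lemma vdot_vcross_move: "vdot a (vcross h u) = vdot (vcross a h) u"
  using vdet_triple[of a h u] by (simp add: vdet_def)

text \<open>The vectors \<open>vcross h u\<close> fill the plane orthogonal to \<open>h\<close>, too
  large to lie in the line spanned by \<open>w\<close>; the unit vectors already provide a suitable
  \<open>u\<close>.\<close>

lemma ex_vcross_nonparallel:
  fixes h w :: "'k::idom \<times> 'k \<times> 'k"
  assumes "h \<noteq> vzero" "w \<noteq> vzero"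
  shows "\<exists>u. vcross (vcross h u) w \<noteq> vzero"
proof -
  obtain a b c x y z where e: "h = (a, b, c)" "w = (x, y, z)"
    by (cases h; cases w) blast
  show ?thesis
  proof (rule ccontr)
    assume "\<not> ?thesis"
    then have *: "vcross (vcross h u) w = vzero" for u
      by blast
    show False
      using assms *[of "(1, 0, 0)"] *[of "(0, 1, 0)"] *[of "(0, 0, 1)"] e by auto
  qed
qed

section \<open>Vector-valued polynomial maps\<close>

definition linepoly_vec :: "(('i \<Rightarrow> 'k::comm_ring_1) \<Rightarrow> 'k \<times> 'k \<times> 'k) \<Rightarrow> bool" where
  "linepoly_vec F \<longleftrightarrow>
     linepoly (\<lambda>x. fst (F x)) \<and> linepoly (\<lambda>x. fst (snd (F x))) \<and> linepoly (\<lambda>x. snd (snd (F x)))"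

lemma linepoly_vecI:
  "linepoly F \<Longrightarrow> linepoly G \<Longrightarrow> linepoly H \<Longrightarrow> linepoly_vec (\<lambda>x. (F x, G x, H x))"
  by (simp add: linepoly_vec_def)

text \<open>The defining equations match explicit triples only; the versions with projections also
  rewrite values \<open>F x\<close> under a binder.\<close>

lemma vcross_prod: "vcross u v =
    (fst (snd u) * snd (snd v) - snd (snd u) * fst (snd v),
     snd (snd u) * fst v - fst u * snd (snd v), fst u * fst (snd v) - fst (snd u) * fst v)"
  by (cases u; cases v) simp

lemma vdot_prod: "vdot u v = fst u * fst v + fst (snd u) * fst (snd v) + snd (snd u) * snd (snd v)"
  by (cases u; cases v) simp

lemma vscale_prod: "vscale s v = (s * fst v, s * fst (snd v), s * snd (snd v))"
  by (cases v) simp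

lemma linepoly_vcross:
  "linepoly_vec F \<Longrightarrow> linepoly_vec G \<Longrightarrow> linepoly_vec (\<lambda>x. vcross (F x) (G x))"
  unfolding linepoly_vec_def vcross_prod
  by (simp add: linepoly_diff linepoly_mult)

lemma linepoly_vdot:
  "linepoly_vec F \<Longrightarrow> linepoly_vec G \<Longrightarrow> linepoly (\<lambda>x. vdot (F x) (G x))"
  unfolding linepoly_vec_def vdot_prod
  by (simp add: linepoly_add linepoly_mult)

lemma linepoly_vscale:
  "linepoly F \<Longrightarrow> linepoly_vec G \<Longrightarrow> linepoly_vec (\<lambda>x. vscale (F x) (G x))"
  unfolding linepoly_vec_def vscale_prod
  by (simp add: linepoly_mult)

text \<open>Being nonzero is a union of three open conditions. Pairing with a fixed \<open>u\<close>
  that detects the given nonzero value replaces it by a single polynomial.\<close>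

lemma generically_nonzero_vec:
  assumes "linepoly_vec F" "F x \<noteq> vzero"
  shows "generically (\<lambda>x. F x \<noteq> vzero)"
proof -
  have c: "linepoly_vec (\<lambda>x. u)" for u :: "'b \<times> 'b \<times> 'b"
    by (simp add: linepoly_vec_def linepoly_const)
  obtain u where "vdot (F x) u \<noteq> 0"
    using vdot_all_zero assms(2) by blast
  then have "generically (\<lambda>x. vdot (F x) u \<noteq> 0)"
    by (intro generically_nonzero linepoly_vdot assms(1) c)
  then show ?thesis
    by (rule generically_mono) auto
qed

section \<open>Minors and the configuration space\<close>

definition mcol :: "'k mat \<Rightarrow> nat \<Rightarrow> 'k \<times> 'k \<times> 'k" where
  "mcol M j = (M $$ (0, j), M $$ (1, j), M $$ (2, j))"

section \<open>Minors of order at most three in terms of columns\<close>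

lemma pick_singleton: "pick {a} 0 = a"
  by (simp add: Least_equality)

lemma pick_pair:
  assumes "a < b"
  shows "pick {a, b} 0 = a" "pick {a, b} (Suc 0) = b"
proof -
  show 0: "pick {a, b} 0 = a"
    using assms by (simp, intro Least_equality) auto
  show "pick {a, b} (Suc 0) = b"
    using assms by (simp only: pick.simps(2) 0, intro Least_equality) auto
qed

lemma pick_triple:
  assumes "a < b" "b < c"
  shows "pick {a, b, c} 0 = a" "pick {a, b, c} (Suc 0) = b" "pick {a, b, c} (Suc (Suc 0)) = c"
proof -
  show 0: "pick {a, b, c} 0 = a"
    using assms by (simp, intro Least_equality) auto
  show 1: "pick {a, b, c} (Suc 0) = b"
    using assms by (simp only: pick.simps(2) 0, intro Least_equality) auto
  show "pick {a, b, c} (Suc (Suc 0)) = c"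
    using assms by (simp only: pick.simps(2)[of _ "Suc 0"] 1, intro Least_equality) auto
qed

lemma det_1: "det (mat 1 1 f) = f (0, 0)"
  by (subst det_single) auto

lemma det_2: "det (mat 2 2 f) = f (0, 0) * f (1, 1) - f (0, 1) * (f (1, 0) :: 'a::comm_ring_1)"
  by (subst laplace_expansion_column[of _ 2 0])
    (auto simp: cofactor_def mat_delete_def numeral_2_eq_2 det_1[unfolded One_nat_def])

lemma det_3: "det (mat 3 3 f) = vdet (f (0, 0), f (1, 0), f (2, 0)) (f (0, 1), f (1, 1), f (2, 1))
    (f (0, 2), f (1, 2), f (2, 2) :: 'a::comm_ring_1)"
  by (subst laplace_expansion_column[of _ 3 0])
    (auto simp: cofactor_def mat_delete_def numeral_3_eq_3 numeral_2_eq_2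
      det_2[unfolded One_nat_def numeral_2_eq_2] vdet_def algebra_simps)

lemma submatrix_square:
  assumes "M \<in> carrier_mat m n" "A \<subseteq> {..<m}" "B \<subseteq> {..<n}"
  shows "submatrix M A B = mat (card A) (card B) (\<lambda>(i, j). M $$ (pick A i, pick B j))"
proof -
  have "{i. i < m \<and> i \<in> A} = A" "{j. j < n \<and> j \<in> B} = B"
    using assms by auto
  then show ?thesis
    using assms(1) by (simp add: submatrix_def)
qed

lemma lessThan_3: "{..<3} = {0, 1, 2 :: nat}"
  by auto

lemma minor_1:
  assumes "M \<in> carrier_mat 3 n" "a < 3" "i < n"
  shows "det (submatrix M {a} {i}) = M $$ (a, i)"
  using assms by (simp add: submatrix_square pick_singleton det_1[unfolded One_nat_def] del: pick.simps)

lemma minor_2: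
  assumes "M \<in> carrier_mat 3 n" "a < b" "b < 3" "i < j" "j < n"
  shows "det (submatrix M {a, b} {i, j}) = M $$ (a, i) * M $$ (b, j) - M $$ (a, j) * M $$ (b, i)"
  using assms
  by (simp add: submatrix_square pick_pair det_2 numeral_2_eq_2[symmetric] del: pick.simps)

lemma minor_3:
  assumes "M \<in> carrier_mat 3 n" "i < j" "j < k" "k < n"
  shows "det (submatrix M {..<3} {i, j, k}) = vdet (mcol M i) (mcol M j) (mcol M k)"
proof -
  have c: "card {i, j, k} = 3" "card {..<3 :: nat} = 3"
    using assms by auto
  have "submatrix M {..<3} {i, j, k} =
      mat 3 3 (\<lambda>(a, b). M $$ (pick {..<3} a, pick {i, j, k} b))"
    using assms by (subst submatrix_square[where m=3 and n=n]) (simp_all add: c)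
  then show ?thesis
    using pick_triple[of 0 1 2] pick_triple[of i j k] assms
    by (simp add: det_3 mcol_def lessThan_3 numeral_2_eq_2 del: pick.simps)
qed

text \<open>The complement of the locus of \<open>basis_ideal\<close>: for at most three columns,
  their linear independence.\<close>

definition free_cols :: "'k::comm_ring_1 mat \<Rightarrow> nat set \<Rightarrow> bool" where
  "free_cols M B \<longleftrightarrow> (\<exists>A\<subseteq>{..<3}. card A = card B \<and> det (submatrix M A B) \<noteq> 0)"

text \<open>The case of an arrangement whose elements are all zero points: its only basis is the
  empty set, and the empty determinant is 1.\<close>

lemma free_cols_empty: "free_cols M {}"
  unfolding free_cols_def by (intro exI[of _ "{}"]) (auto simp: submatrix_def)

lemma free_cols_1:
  assumes "M \<in> carrier_mat 3 n" "i < n"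
  shows "free_cols M {i} \<longleftrightarrow> mcol M i \<noteq> vzero"
proof
  assume "free_cols M {i}"
  then obtain a where "a < 3" "M $$ (a, i) \<noteq> 0"
    using minor_1[OF assms(1) _ assms(2)] by (auto simp: free_cols_def card_1_singleton_iff)
  moreover from this have "a = 0 \<or> a = 1 \<or> a = 2"
    by auto
  ultimately show "mcol M i \<noteq> vzero"
    by (auto simp: mcol_def)
next
  assume "mcol M i \<noteq> vzero"
  then obtain a where "a < 3" "M $$ (a, i) \<noteq> 0"
    using that[of 0] that[of 1] that[of 2] by (auto simp: mcol_def)
  then show "free_cols M {i}"
    unfolding free_cols_def using minor_1[OF assms(1) _ assms(2)]
    by (intro exI[of _ "{a}"]) auto
qed

lemma pairs_of_rows: "{A. A \<subseteq> {..<3 :: nat} \<and> card A = 2} = {{0, 1}, {0, 2}, {1, 2}}"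
proof (intro equalityI subsetI)
  fix A :: "nat set"
  assume "A \<in> {A. A \<subseteq> {..<3} \<and> card A = 2}"
  then obtain x y where "A = {x, y}" "x \<noteq> y" "x < 3" "y < 3"
    by (auto simp: card_2_iff)
  moreover have "x \<in> {0, 1, 2}" "y \<in> {0, 1, 2}"
    using calculation by auto
  ultimately show "A \<in> {{0, 1}, {0, 2}, {1, 2}}"
    by (auto simp: insert_commute)
qed (auto simp: lessThan_3)

text \<open>The three 2-minors of two columns are, up to sign, the coordinates of their cross
  product.\<close>

lemma minors_2_vanish:
  assumes M: "M \<in> carrier_mat 3 n" and ij: "i < n" "j < n" "i \<noteq> j"
  shows "(\<forall>A\<subseteq>{..<3}. card A = 2 \<longrightarrow> det (submatrix M A {i, j}) = 0) \<longleftrightarrow>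
    vcross (mcol M i) (mcol M j) = vzero"
proof -
  have *: "(\<forall>A\<subseteq>{..<3}. card A = 2 \<longrightarrow> det (submatrix M A {i, j}) = 0) \<longleftrightarrow>
      vcross (mcol M i) (mcol M j) = vzero" if "i < j" "j < n" for i j
  proof -
    have "(\<forall>A\<subseteq>{..<3}. card A = 2 \<longrightarrow> det (submatrix M A {i, j}) = 0) \<longleftrightarrow>
        (\<forall>A\<in>{{0, 1}, {0, 2}, {1, 2}}. det (submatrix M A {i, j}) = 0)"
      unfolding pairs_of_rows[symmetric] by blast
    then show ?thesis
      using that minor_2[OF M, of 0 1 i j] minor_2[OF M, of 0 2 i j] minor_2[OF M, of 1 2 i j]
      by (auto simp: mcol_def algebra_simps)
  qed
  show ?thesis
    using *[of i j] *[of j i] ij vcross_swap_eq_zero[of "mcol M i" "mcol M j"]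
    by (cases "i < j") (simp_all add: insert_commute)
qed

lemma free_cols_2:
  assumes "M \<in> carrier_mat 3 n" "i < n" "j < n" "i \<noteq> j"
  shows "free_cols M {i, j} \<longleftrightarrow> vcross (mcol M i) (mcol M j) \<noteq> vzero"
  using minors_2_vanish[OF assms] assms(4) by (auto simp: free_cols_def)

lemma minor_3_vanish:
  assumes M: "M \<in> carrier_mat 3 n" and ijk: "i < n" "j < n" "k < n" "i \<noteq> j" "i \<noteq> k" "j \<noteq> k"
  shows "det (submatrix M {..<3} {i, j, k}) = 0 \<longleftrightarrow> vdet (mcol M i) (mcol M j) (mcol M k) = 0"
proof -
  let ?P = "\<lambda>i j k. det (submatrix M {..<3} {i, j, k}) = 0 \<longleftrightarrow> vdet (mcol M i) (mcol M j) (mcol M k) = 0"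
  have base: "?P i j k" if "i < j" "j < k" "k < n" for i j k
    using minor_3[OF M that] by simp
  \<comment> \<open>A column set forgets the order of its indices. Both sides are invariant under a
    transposition and a rotation, which generate all orders.\<close>
  have swap: "?P i j k \<longleftrightarrow> ?P j i k" for i j k
    by (simp add: insert_commute vdet_swap[of "mcol M i" "mcol M j"])
  have rot: "?P i j k \<longleftrightarrow> ?P j k i" for i j k
    by (simp add: insert_commute vdet_rotate[of "mcol M i" "mcol M j"])
  consider "i < j \<and> j < k" | "i < k \<and> k < j" | "j < i \<and> i < k" | "j < k \<and> k < i" | "k < i \<and> i < j"
    | "k < j \<and> j < i"
    using ijk by linarith
  then show ?thesis
    using ijk base swap rot by cases metis+
qed

lemma free_cols_3:
  assumes "M \<in> carrier_mat 3 n" "i < n" "j < n" "k < n" "i \<noteq> j" "i \<noteq> k" "j \<noteq> k"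
  shows "free_cols M {i, j, k} \<longleftrightarrow> vdet (mcol M i) (mcol M j) (mcol M k) \<noteq> 0"
proof -
  have "A = {..<3}" if "A \<subseteq> {..<3}" "card A = 3" for A :: "nat set"
    using that by (intro card_subset_eq) auto
  moreover have "card {i, j, k} = 3"
    using assms(5-7) by simp
  ultimately show ?thesis
    unfolding free_cols_def using minor_3_vanish[OF assms]
    by (metis card_lessThan order_refl)
qed

text \<open>Turns the ideal-theoretic definition into vector algebra: ideals are tested on
  generators, and minors become coordinates, cross products and triple products. Equal indices
  within a block add nothing, a vector being parallel to itself.\<close>

lemma config_space_iff:
  fixes M :: "'k::comm_ring_1 mat"
  assumes L: "line_arrangement n L"
  shows "M \<in> config_space n L \<longleftrightarrow> M \<in> carrier_mat 3 n \<and>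
    (\<forall>j\<in>zeros L. mcol M j = vzero) \<and>
    (\<forall>P\<in>blocks L. \<forall>i\<in>P. \<forall>j\<in>P. vcross (mcol M i) (mcol M j) = vzero) \<and>
    (\<forall>i j k. i \<noteq> j \<and> i \<noteq> k \<and> j \<noteq> k \<and> collinear L {i, j, k} \<longrightarrow>
      vdet (mcol M i) (mcol M j) (mcol M k) = 0) \<and>
    (\<forall>B. is_basis n L B \<longrightarrow> free_cols M B)"
proof (cases "M \<in> carrier_mat 3 n")
  case M: True
  have blk: "P \<subseteq> {..<n} - zeros L" if "P \<in> blocks L" for P
    using L that by (auto simp: line_arrangement_def partition_on_def)
  have inc: "P \<in> blocks L" if "(P, l) \<in> incid L" for P l
    using L that by (auto simp: line_arrangement_def)
  have zer: "zeros L \<subseteq> {..<n}"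
    using L by (simp add: line_arrangement_def)
  \<comment> \<open>Points incident with a line lie in blocks, so the range condition on the index
    set is automatic.\<close>
  have col: "{i, j, k} \<subseteq> {..<n} - zeros L" if "collinear L {i, j, k}" for i j k
    using that blk inc unfolding collinear_def by blast
  have "M \<in> vanishing_locus n (N_ideal n L) \<longleftrightarrow> (\<forall>p\<in>arr_generators n L. peval M p = 0)"
    unfolding N_ideal_def locus_genideal[OF arr_generators_carrier[OF L]]
    using M by (simp add: vanishing_locus_def)
  also have "\<dots> \<longleftrightarrow> (\<forall>j\<in>zeros L. \<forall>i<3. M $$ (i, j) = 0) \<and>
      (\<forall>P\<in>blocks L. \<forall>B. B \<subseteq> P \<and> card B = 2 \<longrightarrow>
        (\<forall>A\<subseteq>{..<3}. card A = 2 \<longrightarrow> det (submatrix M A B) = 0)) \<and>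
      (\<forall>B. B \<subseteq> {..<n} - zeros L \<and> card B = 3 \<and> collinear L B \<longrightarrow> det (submatrix M {..<3} B) = 0)"
  proof -
    have "(\<forall>p\<in>{var i j | i j. i < 3 \<and> j \<in> zeros L}. peval M p = 0) \<longleftrightarrow>
        (\<forall>j\<in>zeros L. \<forall>i<3. peval M (var i j) = 0)"
      by blast
    moreover have "(\<forall>p\<in>{minor n A B | A B. A \<subseteq> {..<3} \<and> card A = 2 \<and> card B = 2 \<and>
          (\<exists>P\<in>blocks L. B \<subseteq> P)}. peval M p = 0) \<longleftrightarrow>
        (\<forall>P\<in>blocks L. \<forall>B. B \<subseteq> P \<and> card B = 2 \<longrightarrow>
          (\<forall>A\<subseteq>{..<3}. card A = 2 \<longrightarrow> peval M (minor n A B) = 0))"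
      by blast
    moreover have "(\<forall>p\<in>{minor n {..<3} B | B. B \<subseteq> {..<n} - zeros L \<and> card B = 3 \<and> collinear L B}.
          peval M p = 0) \<longleftrightarrow>
        (\<forall>B. B \<subseteq> {..<n} - zeros L \<and> card B = 3 \<and> collinear L B \<longrightarrow>
          peval M (minor n {..<3} B) = 0)"
      by blast
    ultimately show ?thesis
      unfolding arr_generators_def ball_Un by (simp add: peval_var peval_minor[OF M])
  qed
  also have "(\<forall>j\<in>zeros L. \<forall>i<3. M $$ (i, j) = 0) \<longleftrightarrow> (\<forall>j\<in>zeros L. mcol M j = vzero)"
    by (auto simp: mcol_def less_Suc_eq numeral_3_eq_3 numeral_2_eq_2)
  also have "(\<forall>P\<in>blocks L. \<forall>B. B \<subseteq> P \<and> card B = 2 \<longrightarrow>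
        (\<forall>A\<subseteq>{..<3}. card A = 2 \<longrightarrow> det (submatrix M A B) = 0)) \<longleftrightarrow>
      (\<forall>P\<in>blocks L. \<forall>i\<in>P. \<forall>j\<in>P. vcross (mcol M i) (mcol M j) = vzero)"
  proof (intro ball_cong refl iffI ballI allI impI, goal_cases)
    case (1 P i j)
    then have "i < n" "j < n"
      using blk by auto
    then show ?case
      using minors_2_vanish[OF M, of i j] 1(2)[rule_format, of "{i, j}"] 1 by (cases "i = j") auto
  next
    case (2 P B A)
    then obtain i j where "B = {i, j}" "i \<noteq> j"
      by (auto simp: card_2_iff)
    then show ?case
      using minors_2_vanish[OF M, of i j] 2 blk[of P] by blast
  qed
  also have "(\<forall>B. B \<subseteq> {..<n} - zeros L \<and> card B = 3 \<and> collinear L B \<longrightarrow>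
      det (submatrix M {..<3} B) = 0) \<longleftrightarrow>
      (\<forall>i j k. i \<noteq> j \<and> i \<noteq> k \<and> j \<noteq> k \<and> collinear L {i, j, k} \<longrightarrow>
      vdet (mcol M i) (mcol M j) (mcol M k) = 0)"
  proof (intro iffI allI impI, goal_cases)
    case (1 i j k)
    then have "{i, j, k} \<subseteq> {..<n} - zeros L" "card {i, j, k} = 3"
      using col by auto
    then show ?case
      using minor_3_vanish[OF M, of i j k] 1 by auto
  next
    case (2 B)
    then obtain i j k where B: "B = {i, j, k}" and ijk: "i \<noteq> j" "i \<noteq> k" "j \<noteq> k"
      by (auto simp: card_3_iff)
    with 2 have "i < n" "j < n" "k < n" "vdet (mcol M i) (mcol M j) (mcol M k) = 0"
      by auto
    then show ?case
      using minor_3_vanish[OF M, of i j k] ijk B by simp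
  qed
  finally have N: "M \<in> vanishing_locus n (N_ideal n L) \<longleftrightarrow>
    (\<forall>j\<in>zeros L. mcol M j = vzero) \<and>
    (\<forall>P\<in>blocks L. \<forall>i\<in>P. \<forall>j\<in>P. vcross (mcol M i) (mcol M j) = vzero) \<and>
    (\<forall>i j k. i \<noteq> j \<and> i \<noteq> k \<and> j \<noteq> k \<and> collinear L {i, j, k} \<longrightarrow>
      vdet (mcol M i) (mcol M j) (mcol M k) = 0)" .
  have "M \<notin> vanishing_locus n (basis_ideal n B) \<longleftrightarrow> free_cols M B" if "is_basis n L B" for B
  proof -
    have "B \<subseteq> {..<n}"
      using that by (simp add: is_basis_def independent_def)
    then have carr: "{minor n A B | A. A \<subseteq> {..<3} \<and> card A = card B} \<subseteq>
        carrier (poly_ring n :: 'k mpoly ring)"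
      using minor_carrier[where 'k='k] by blast
    have "(\<forall>p\<in>{minor n A B | A. A \<subseteq> {..<3} \<and> card A = card B}. peval M p = 0) \<longleftrightarrow> \<not> free_cols M B"
      unfolding free_cols_def peval_minor[OF M, symmetric] by blast
    then show ?thesis
      unfolding basis_ideal_def locus_genideal[OF carr] using M
      by (simp add: vanishing_locus_def)
  qed
  then have "M \<notin> (\<Union>B\<in>{B. is_basis n L B}. vanishing_locus n (basis_ideal n B)) \<longleftrightarrow>
      (\<forall>B. is_basis n L B \<longrightarrow> free_cols M B)"
    by blast
  then show ?thesis
    unfolding config_space_def Diff_iff N by (simp only: M simp_thms conj_assoc)
qed (auto simp: config_space_def vanishing_locus_def)

section \<open>The parametrisation\<close>

text \<open>One scalar coordinate per value; \<open>pvec\<close> reads three of them as a vector.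
  With unrestricted indices the parameter space is the whole function space, which contains the line
  through any two parameters.\<close>

datatype 'l param = Centre nat | Line 'l nat | Point "nat set" nat | Scale nat

definition pvec :: "(nat \<Rightarrow> 'l param) \<Rightarrow> ('l param \<Rightarrow> 'k) \<Rightarrow> 'k \<times> 'k \<times> 'k" where
  "pvec c x = (x (c 0), x (c 1), x (c 2))"

definition comp3 :: "'k \<times> 'k \<times> 'k \<Rightarrow> nat \<Rightarrow> 'k" where
  "comp3 v i = (if i = 0 then fst v else if i = 1 then fst (snd v) else snd (snd v))"

lemma pvec_comp3: "(\<And>i. x (c i) = comp3 v i) \<Longrightarrow> pvec c x = v"
  by (cases v) (simp add: pvec_def comp3_def)

lemma linepoly_pvec: "linepoly_vec (pvec c :: _ \<Rightarrow> 'k::comm_ring_1 \<times> 'k \<times> 'k)"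
  unfolding pvec_def[abs_def] by (intro linepoly_vecI linepoly_coord)

lemma linepoly_comp3: "linepoly_vec F \<Longrightarrow> linepoly (\<lambda>x. comp3 (F x) i)"
  unfolding linepoly_vec_def comp3_def by (cases "i = 0"; cases "i = 1") simp_all

section \<open>Incidences among at most four lines\<close>

locale few_lines =
  fixes n :: nat and L :: "'l arrangement"
  assumes arrangement: "line_arrangement n L"
    and finite_lines: "finite (lines L)" and card_lines: "card (lines L) \<le> 4"
begin

definition through :: "nat set \<Rightarrow> 'l set" where
  "through P = {l. (P, l) \<in> incid L}"

lemma blocks_subset: "P \<in> blocks L \<Longrightarrow> P \<subseteq> {..<n} - zeros L"
  using arrangement by (auto simp: line_arrangement_def partition_on_def)

lemma zeros_subset: "zeros L \<subseteq> {..<n}"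
  using arrangement by (simp add: line_arrangement_def)

lemma block_nonempty: "P \<in> blocks L \<Longrightarrow> P \<noteq> {}"
  using arrangement by (auto simp: line_arrangement_def partition_on_def)

lemma block_unique: "P \<in> blocks L \<Longrightarrow> Q \<in> blocks L \<Longrightarrow> i \<in> P \<Longrightarrow> i \<in> Q \<Longrightarrow> P = Q"
proof -
  have "disjoint (blocks L)"
    using arrangement by (simp add: line_arrangement_def partition_on_def)
  then show "P \<in> blocks L \<Longrightarrow> Q \<in> blocks L \<Longrightarrow> i \<in> P \<Longrightarrow> i \<in> Q \<Longrightarrow> P = Q"
    unfolding disjoint_def by blast
qed

lemma block_ex: "i < n \<Longrightarrow> i \<notin> zeros L \<Longrightarrow> \<exists>P\<in>blocks L. i \<in> P"
  using arrangement by (auto simp: line_arrangement_def partition_on_def)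

lemma finite_blocks: "finite (blocks L)"
proof (rule finite_subset)
  show "blocks L \<subseteq> Pow {..<n}"
    using blocks_subset by blast
qed simp

lemma through_block: "l \<in> through P \<Longrightarrow> P \<in> blocks L"
  and through_line: "l \<in> through P \<Longrightarrow> l \<in> lines L"
  using arrangement by (auto simp: line_arrangement_def through_def)

lemma through_subset: "through P \<subseteq> lines L"
  using through_line by blast

lemma finite_through: "finite (through P)"
  using through_subset finite_lines finite_subset by blast

lemma two_points_one_line:
  assumes "P \<noteq> Q" "l \<in> through P" "l \<in> through Q" "m \<in> through P" "m \<in> through Q"
  shows "l = m"
  using arrangement assms(1) through_block[OF assms(2)] through_block[OF assms(3)] assms(2-5)
  unfolding line_arrangement_def through_def by blast

lemma line_two_points:
  assumes "l \<in> lines L"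
  obtains P Q where "P \<noteq> Q" "l \<in> through P" "l \<in> through Q"
proof -
  have "3 \<le> card {P. (P, l) \<in> incid L}"
    using arrangement assms by (auto simp: line_arrangement_def)
  then have "\<not> card {P. (P, l) \<in> incid L} \<le> Suc 0"
    by linarith
  moreover have "finite {P. (P, l) \<in> incid L}"
    by (rule finite_subset[OF _ finite_blocks]) (use through_block in \<open>auto simp: through_def\<close>)
  ultimately obtain P Q where "P \<noteq> Q" "P \<in> {P. (P, l) \<in> incid L}" "Q \<in> {P. (P, l) \<in> incid L}"
    by (auto simp: card_le_Suc0_iff_eq)
  then show ?thesis
    using that by (simp add: through_def)
qed

lemma line_not_contained:
  assumes "l \<in> lines L" "l \<noteq> m"
  obtains R where "l \<in> through R" "m \<notin> through R"
  using line_two_points[OF assms(1)] two_points_one_line assms(2) by metis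

definition multiple :: "nat set \<Rightarrow> bool" where
  "multiple P \<longleftrightarrow> 3 \<le> card (through P)"

text \<open>This is where the bound on the number of lines enters: two points lying on at least three
  of the four lines each would share two lines.\<close>

lemma multiple_unique:
  assumes "multiple P" "multiple Q"
  shows "P = Q"
proof (rule ccontr)
  assume "P \<noteq> Q"
  then have "card (through P \<inter> through Q) \<le> Suc 0"
    using two_points_one_line finite_through by (auto simp: card_le_Suc0_iff_eq)
  moreover have "card (through P \<union> through Q) \<le> 4"
    using card_mono[OF finite_lines, of "through P \<union> through Q"] through_subset card_lines
    by (meson Un_least le_trans)
  ultimately show False
    using card_Un_Int[OF finite_through finite_through, of P Q] assms by (simp add: multiple_def)
qed

definition pencil :: "'l \<Rightarrow> bool" where
  "pencil l \<longleftrightarrow> (\<exists>P. multiple P \<and> l \<in> through P)"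

lemma through_multiple: "multiple P \<Longrightarrow> through P = {l \<in> lines L. pencil l}"
  using multiple_unique through_subset unfolding pencil_def by blast

lemma multiple_block: "multiple P \<Longrightarrow> P \<in> blocks L"
  using through_block[of _ P] by (cases "through P = {}") (auto simp: multiple_def)

text \<open>A multiple point already uses three of the four lines.\<close>

lemma one_line_off_pencil:
  assumes "multiple P" "l \<in> lines L" "m \<in> lines L" "\<not> pencil l" "\<not> pencil m"
  shows "l = m"
proof (rule ccontr)
  assume "l \<noteq> m"
  have "card ({l, m} \<union> through P) = card {l, m} + card (through P)"
    by (rule card_Un_disjoint) (use assms in \<open>auto simp: finite_through pencil_def\<close>)
  moreover have "card ({l, m} \<union> through P) \<le> 4"
    using card_mono[OF finite_lines, of "{l, m} \<union> through P"] through_subset[of P] card_lines assms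
    by simp
  ultimately show False
    using \<open>l \<noteq> m\<close> assms(1) by (simp add: multiple_def)
qed

section \<open>Equations of lines, vectors of points, and the resulting matrix\<close>

definition line_form :: "('l param \<Rightarrow> 'k::comm_ring_1) \<Rightarrow> 'l \<Rightarrow> 'k \<times> 'k \<times> 'k" where
  "line_form x l =
     (if pencil l then vcross (pvec Centre x) (pvec (Line l) x) else pvec (Line l) x)"

text \<open>The two lines through a double point come as a set; the choice operator fixes an order,
  which affects only the sign of the vector.\<close>

definition point_vec :: "('l param \<Rightarrow> 'k::comm_ring_1) \<Rightarrow> nat set \<Rightarrow> 'k \<times> 'k \<times> 'k" where
  "point_vec x P =
     (if through P = {} then pvec (Point P) x
      else if card (through P) = 1 then
        vcross (line_form x (SOME l. through P = {l})) (pvec (Point P) x)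
      else if card (through P) = 2 then
        (let (l, m) = (SOME (l, m). through P = {l, m} \<and> l \<noteq> m) in vcross (line_form x l) (line_form x m))
      else pvec Centre x)"

text \<open>Removes the choice operators once and for all. The chosen lines do not depend on
  \<open>x\<close>, so each case gives one formula valid for all parameters, as needed for
  polynomiality.\<close>

lemma point_cases:
  obtains
    (free) "through P = {}" "\<And>x :: 'l param \<Rightarrow> 'k::comm_ring_1. point_vec x P = pvec (Point P) x"
  | (simple) l where "through P = {l}"
      "\<And>x :: 'l param \<Rightarrow> 'k. point_vec x P = vcross (line_form x l) (pvec (Point P) x)"
  | (double) l m where "through P = {l, m}" "l \<noteq> m"
      "\<And>x :: 'l param \<Rightarrow> 'k. point_vec x P = vcross (line_form x l) (line_form x m)"
  | (multiple) "multiple P" "\<And>x :: 'l param \<Rightarrow> 'k. point_vec x P = pvec Centre x"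
proof -
  consider "through P = {}" | "card (through P) = 1" | "card (through P) = 2" | "multiple P"
    using finite_through[of P] card_0_eq[of "through P"] unfolding multiple_def by linarith
  then show ?thesis
  proof cases
    case 1
    then show ?thesis
      using free by (simp add: point_vec_def)
  next
    case 2
    then obtain l where "through P = {l}"
      by (auto simp: card_1_singleton_iff)
    then show ?thesis
      using simple[of l] by (simp add: point_vec_def)
  next
    case 3
    define lm where "lm = (SOME (l, m). through P = {l, m} \<and> l \<noteq> m)"
    have "\<exists>lm. case lm of (l, m) \<Rightarrow> through P = {l, m} \<and> l \<noteq> m"
      using 3 by (auto simp: card_2_iff)
    then have "case lm of (l, m) \<Rightarrow> through P = {l, m} \<and> l \<noteq> m"
      unfolding lm_def by (rule someI_ex)
    moreover obtain l m where lm: "lm = (l, m)"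
      by (cases lm)
    moreover have "point_vec x P = (let (l, m) = lm in vcross (line_form x l) (line_form x m))"
      for x :: "'l param \<Rightarrow> 'k"
      using 3 by (auto simp: point_vec_def lm_def)
    ultimately show ?thesis
      using double[of l m] by simp
  next
    case 4
    then have "through P \<noteq> {}" "card (through P) \<noteq> 1" "card (through P) \<noteq> 2"
      by (auto simp: multiple_def)
    then show ?thesis
      using multiple[OF 4] by (simp add: point_vec_def)
  qed
qed

definition block_of :: "nat \<Rightarrow> nat set" where
  "block_of j = (THE P. P \<in> blocks L \<and> j \<in> P)"

lemma block_of_eq: "P \<in> blocks L \<Longrightarrow> j \<in> P \<Longrightarrow> block_of j = P"
  unfolding block_of_def by (rule the_equality) (simp_all add: block_unique[of _ P j])

definition col_vec :: "('l param \<Rightarrow> 'k::comm_ring_1) \<Rightarrow> nat \<Rightarrow> 'k \<times> 'k \<times> 'k" where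
  "col_vec x j = (if j \<in> zeros L then vzero else vscale (x (Scale j)) (point_vec x (block_of j)))"

definition realize :: "('l param \<Rightarrow> 'k::comm_ring_1) \<Rightarrow> 'k mat" where
  "realize x = mat 3 n (\<lambda>(i, j). comp3 (col_vec x j) i)"

lemma realize_carrier [simp]: "realize x \<in> carrier_mat 3 n"
  by (simp add: realize_def)

lemma mcol_realize: "j < n \<Longrightarrow> mcol (realize x) j = col_vec x j"
  by (cases "col_vec x j") (simp add: mcol_def realize_def comp3_def)

lemma mcol_realize_block:
  "P \<in> blocks L \<Longrightarrow> j \<in> P \<Longrightarrow> mcol (realize x) j = vscale (x (Scale j)) (point_vec x P)"
  using blocks_subset[of P] by (subst mcol_realize) (auto simp: col_vec_def block_of_eq)

lemma linepoly_line_form: "linepoly_vec (\<lambda>x :: 'l param \<Rightarrow> 'k::comm_ring_1. line_form x l)"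
  unfolding line_form_def by (cases "pencil l") (simp_all add: linepoly_vcross linepoly_pvec)

lemma linepoly_point_vec: "linepoly_vec (\<lambda>x :: 'l param \<Rightarrow> 'k::comm_ring_1. point_vec x P)"
  by (cases P rule: point_cases[where 'k='k])
    (simp_all add: linepoly_vcross linepoly_pvec linepoly_line_form)

lemma linepoly_col_vec: "linepoly_vec (\<lambda>x :: 'l param \<Rightarrow> 'k::comm_ring_1. col_vec x j)"
proof (cases "j \<in> zeros L")
  case True
  then show ?thesis
    by (simp add: col_vec_def linepoly_vec_def linepoly_const)
next
  case False
  then show ?thesis
    by (simp add: col_vec_def linepoly_vscale linepoly_coord linepoly_point_vec)
qed

lemma linepoly_peval_realize:
  fixes f :: "'k::comm_ring_1 mpoly"
  assumes "f \<in> carrier (poly_ring n)"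
  shows "linepoly (\<lambda>x. peval (realize x) f)"
  unfolding peval_def
proof (intro linepoly_sum linepoly_mult linepoly_const linepoly_prod linepoly_power)
  fix m v
  assume "m \<in> Poly_Mapping.keys f" "v \<in> Poly_Mapping.keys m"
  \<comment> \<open>Membership in the polynomial ring guarantees that only genuine matrix entries
    are read; only for these does \<open>realize\<close> give a formula.\<close>
  then have "fst v < 3" "snd v < n"
    using assms by (auto simp: mvars_def)
  then have "realize x $$ v = comp3 (col_vec x (snd v)) (fst v)" for x :: "'l param \<Rightarrow> 'k"
    by (cases v) (simp add: realize_def)
  then show "linepoly (\<lambda>x :: 'l param \<Rightarrow> 'k. realize x $$ v)"
    by (simp add: linepoly_comp3 linepoly_col_vec)
qed

lemma point_on_line:
  fixes x :: "'l param \<Rightarrow> 'k::comm_ring_1"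
  assumes "l \<in> through P"
  shows "vdot (line_form x l) (point_vec x P) = 0"
proof (cases P rule: point_cases[where 'k='k])
  case multiple
  then have "pencil l"
    using assms pencil_def by blast
  then show ?thesis
    by (simp add: multiple line_form_def vdot_commute[of "vcross _ _"] vdot_vcross)
qed (use assms in \<open>auto simp: vdot_vcross\<close>)

text \<open>Every point on a line, apart from the centre, is a cross product with the equation of
  that line. This covers degenerate parameters.\<close>

lemma point_on_zero_line:
  fixes x :: "'l param \<Rightarrow> 'k::comm_ring_1"
  assumes "l \<in> through P" "line_form x l = vzero" "\<not> multiple P"
  shows "point_vec x P = vzero"
  by (cases P rule: point_cases[where 'k='k]) (use assms in auto)

lemma realize_relations:
  fixes x :: "'l param \<Rightarrow> 'k::idom"
  shows "j \<in> zeros L \<Longrightarrow> mcol (realize x) j = vzero"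
    and "P \<in> blocks L \<Longrightarrow> i \<in> P \<Longrightarrow> j \<in> P \<Longrightarrow> vcross (mcol (realize x) i) (mcol (realize x) j) = vzero"
    and "collinear L {i, j, k} \<Longrightarrow>
      vdet (mcol (realize x) i) (mcol (realize x) j) (mcol (realize x) k) = 0"
proof -
  show "mcol (realize x) j = vzero" if "j \<in> zeros L"
    using that zeros_subset by (subst mcol_realize) (auto simp: col_vec_def)
  show same: "vcross (mcol (realize x) i) (mcol (realize x) j) = vzero"
    if "P \<in> blocks L" "i \<in> P" "j \<in> P" for P i j
    using that by (simp add: mcol_realize_block vcross_vscale)
  assume "collinear L {i, j, k}"
  then obtain l P Q R where l: "l \<in> through P" "l \<in> through Q" "l \<in> through R"
    and ijk: "i \<in> P" "j \<in> Q" "k \<in> R"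
    by (auto simp: collinear_def through_def)
  have blk: "P \<in> blocks L" "Q \<in> blocks L" "R \<in> blocks L"
    using l through_block by blast+
  note col = mcol_realize_block[OF blk(1) ijk(1)] mcol_realize_block[OF blk(2) ijk(2)]
    mcol_realize_block[OF blk(3) ijk(3)]
  show "vdet (mcol (realize x) i) (mcol (realize x) j) (mcol (realize x) k) = 0"
  proof (cases "line_form x l = vzero")
    case False
    then show ?thesis
      using l by (intro ortho_triple_vdet[OF False]) (simp_all add: col vdot_vscale point_on_line)
  next
    case True
    \<comment> \<open>The equation of the common line is zero and gives no dependence. If all three
      blocks are multiple, they coincide and their columns are parallel; otherwise some column is
      zero.\<close>
    consider "\<not> multiple P" | "\<not> multiple Q" | "\<not> multiple R" | "P = Q"
      using multiple_unique by blast
    then show ?thesis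
    proof cases
      case 1
      then show ?thesis
        using point_on_zero_line[OF l(1) True] by (simp add: col vdet_def)
    next
      case 2
      then show ?thesis
        using point_on_zero_line[OF l(2) True] by (simp add: col vdet_def)
    next
      case 3
      then show ?thesis
        using point_on_zero_line[OF l(3) True] by (simp add: col vdet_def)
    next
      case 4
      then show ?thesis
        using same[OF blk(1) ijk(1), of j] ijk(2) by (simp add: vdet_triple)
    qed
  qed
qed

end

section \<open>Every configuration is parametrised\<close>

lemma free_cols_nonzero:
  assumes M: "M \<in> carrier_mat 3 n" and B: "B \<subseteq> {..<n}" "card B \<le> 3" and free: "free_cols M B"
    and i: "i \<in> B"
  shows "mcol M i \<noteq> vzero"
proof -
  have fin: "finite B"
    using B(1) finite_subset by blast
  then have "card (B - {i}) = 0 \<or> card (B - {i}) = 1 \<or> card (B - {i}) = 2"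
    using B(2) i by auto
  then consider "B - {i} = {}" | j where "B - {i} = {j}" | j k where "B - {i} = {j, k}" "j \<noteq> k"
    using fin by (auto simp: card_1_singleton_iff card_2_iff)
  then show ?thesis
  proof cases
    case 1
    then have "B = {i}"
      using i by blast
    then show ?thesis
      using free free_cols_1[OF M, of i] B(1) by auto
  next
    case 2
    then have "B = {i, j}" "i \<noteq> j"
      using i by blast+
    then show ?thesis
      using free free_cols_2[OF M, of i j] B(1) by auto
  next
    case 3
    then have "B = {i, j, k}" "i \<noteq> j" "i \<noteq> k"
      using i by blast+
    then show ?thesis
      using free free_cols_3[OF M, of i j k] B(1) 3 by (auto simp: vdet_def)
  qed
qed

lemma free_cols_nonparallel:
  assumes M: "M \<in> carrier_mat 3 n" and B: "B \<subseteq> {..<n}" "card B \<le> 3" and free: "free_cols M B"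
    and ij: "i \<in> B" "j \<in> B" "i \<noteq> j"
  shows "vcross (mcol M i) (mcol M j) \<noteq> vzero"
proof -
  have fin: "finite B"
    using B(1) finite_subset by blast
  then have "card (B - {i, j}) = card B - 2"
    using ij by (subst card_Diff_subset) auto
  then have "card (B - {i, j}) = 0 \<or> card (B - {i, j}) = 1"
    using B(2) by linarith
  then consider "B - {i, j} = {}" | k where "B - {i, j} = {k}"
    using fin by (auto simp: card_1_singleton_iff)
  then show ?thesis
  proof cases
    case 1
    then have "B = {i, j}"
      using ij by blast
    then show ?thesis
      using free free_cols_2[OF M, of i j] B(1) ij by auto
  next
    case 2
    then have "B = {i, j, k}" "i \<noteq> k" "j \<noteq> k"
      using ij by blast+
    then show ?thesis
      using free free_cols_3[OF M, of i j k] B(1) ij by (auto simp: vdet_triple)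
  qed
qed

lemma mat_eqI_mcol:
  assumes "A \<in> carrier_mat 3 n" "B \<in> carrier_mat 3 n" "\<And>j. j < n \<Longrightarrow> mcol A j = mcol B j"
  shows "A = B"
proof (rule eq_matI)
  fix i j assume "i < dim_row B" "j < dim_col B"
  then have "i = 0 \<or> i = 1 \<or> i = 2" "mcol A j = mcol B j"
    using assms by auto
  then show "A $$ (i, j) = B $$ (i, j)"
    by (auto simp: mcol_def)
qed (use assms in auto)

text \<open>The configuration space constrains bases only. Extension to a basis transfers the
  constraint to single points, pairs and noncollinear triples.\<close>

lemma independent_extends_to_basis:
  assumes "independent n L B"
  shows "\<exists>B'. is_basis n L B' \<and> B \<subseteq> B'"
proof -
  let ?S = "{B'. independent n L B' \<and> B \<subseteq> B'}"
  have "finite ?S"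
    by (rule finite_subset[of _ "Pow {..<n}"]) (auto simp: independent_def)
  moreover have "?S \<noteq> {}"
    using assms by blast
  ultimately obtain B' where "B' \<in> ?S" "\<forall>C\<in>?S. B' \<subseteq> C \<longrightarrow> B' = C"
    using finite_has_maximal[of ?S] by blast
  then have "is_basis n L B'" "B \<subseteq> B'"
    by (auto simp: is_basis_def)
  then show ?thesis
    by blast
qed

context few_lines
begin

section \<open>Independence expressed by blocks and the lines through them\<close>

lemma coincide_iff:
  assumes "P \<in> blocks L" "Q \<in> blocks L" "i \<in> P" "j \<in> Q"
  shows "coincide L i j \<longleftrightarrow> P = Q"
  using assms block_unique unfolding coincide_def by metis

lemma collinear_iff:
  assumes "P \<in> blocks L" "Q \<in> blocks L" "R \<in> blocks L" "i \<in> P" "j \<in> Q" "k \<in> R"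
  shows "collinear L {i, j, k} \<longleftrightarrow> through P \<inter> through Q \<inter> through R \<noteq> {}"
proof
  assume "collinear L {i, j, k}"
  then obtain l P' Q' R' where l: "l \<in> through P'" "l \<in> through Q'" "l \<in> through R'"
    and ijk: "i \<in> P'" "j \<in> Q'" "k \<in> R'"
    by (auto simp: collinear_def through_def)
  then have "P' = P" "Q' = Q" "R' = R"
    using assms block_unique through_block by metis+
  then show "through P \<inter> through Q \<inter> through R \<noteq> {}"
    using l by blast
next
  assume "through P \<inter> through Q \<inter> through R \<noteq> {}"
  then obtain l where l: "l \<in> through P" "l \<in> through Q" "l \<in> through R"
    by blast
  then have "l \<in> lines L"
    using through_line by blast
  then show "collinear L {i, j, k}"
    using l assms(4-6) unfolding collinear_def through_def by blast
qed

lemma independent_1: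
  assumes "P \<in> blocks L" "i \<in> P"
  shows "independent n L {i}"
  using assms blocks_subset[OF assms(1)] by (auto simp: independent_def subset_singleton_iff)

lemma independent_2:
  assumes "P \<in> blocks L" "Q \<in> blocks L" "P \<noteq> Q" "i \<in> P" "j \<in> Q"
  shows "independent n L {i, j}"
proof -
  have "card T \<noteq> 3" if "T \<subseteq> {i, j}" for T
    using card_mono[OF _ that] card_insert_le_m1[of 2 "{j}" i] by simp
  moreover have "\<not> coincide L i j" "\<not> coincide L j i"
    using coincide_iff assms by blast+
  ultimately show ?thesis
    using assms blocks_subset[OF assms(1)] blocks_subset[OF assms(2)]
    by (auto simp: independent_def card_insert_if)
qed

lemma independent_3:
  assumes "P \<in> blocks L" "Q \<in> blocks L" "R \<in> blocks L" "P \<noteq> Q" "P \<noteq> R" "Q \<noteq> R"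
    and "i \<in> P" "j \<in> Q" "k \<in> R" and "through P \<inter> through Q \<inter> through R = {}"
  shows "independent n L {i, j, k}"
proof -
  have T: "\<not> collinear L T" if "T \<subseteq> {i, j, k}" "card T = 3" for T
  proof -
    have "card {i, j, k} \<le> 3"
      by (simp add: card_insert_if)
    then have "T = {i, j, k}"
      using that by (intro card_seteq) auto
    then show ?thesis
      using collinear_iff[OF assms(1-3,7-9)] assms(10) by simp
  qed
  have "\<not> coincide L i j" "\<not> coincide L j i" "\<not> coincide L i k" "\<not> coincide L k i"
    "\<not> coincide L j k" "\<not> coincide L k j"
    using coincide_iff assms(1-9) by blast+
  then show ?thesis
    using assms(1-9) T blocks_subset[OF assms(1)] blocks_subset[OF assms(2)] blocks_subset[OF assms(3)]
    unfolding independent_def by (auto simp: card_insert_if)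
qed

section \<open>Linear algebra of a single configuration\<close>

context
  fixes M :: "'k::field mat"
  assumes M: "M \<in> config_space n L"
begin

lemma config_carrier: "M \<in> carrier_mat 3 n"
  using M by (simp add: config_space_iff[OF arrangement])

lemma config_extend:
  assumes "independent n L B"
  obtains B' where "B \<subseteq> B'" "B' \<subseteq> {..<n}" "card B' \<le> 3" "free_cols M B'"
proof -
  obtain B' where "is_basis n L B'" "B \<subseteq> B'"
    using independent_extends_to_basis[OF assms] by blast
  then show ?thesis
    using that[of B'] M by (auto simp: config_space_iff[OF arrangement] is_basis_def independent_def)
qed

lemma config_nonzero:
  assumes "P \<in> blocks L" "i \<in> P"
  shows "mcol M i \<noteq> vzero"
  by (rule config_extend[OF independent_1[OF assms]])
    (use free_cols_nonzero[OF config_carrier] in blast)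

lemma config_nonparallel:
  assumes "P \<in> blocks L" "Q \<in> blocks L" "P \<noteq> Q" "i \<in> P" "j \<in> Q"
  shows "vcross (mcol M i) (mcol M j) \<noteq> vzero"
proof -
  have "i \<noteq> j"
    using assms block_unique[of P Q i] by auto
  then show ?thesis
    by (rule_tac config_extend[OF independent_2[OF assms]])
      (use free_cols_nonparallel[OF config_carrier] in blast)
qed

lemma config_noncollinear:
  assumes "P \<in> blocks L" "Q \<in> blocks L" "R \<in> blocks L" "P \<noteq> Q" "P \<noteq> R" "Q \<noteq> R"
    and "i \<in> P" "j \<in> Q" "k \<in> R" and "through P \<inter> through Q \<inter> through R = {}"
  shows "vdet (mcol M i) (mcol M j) (mcol M k) \<noteq> 0"
proof -
  have ijk: "i \<noteq> j" "i \<noteq> k" "j \<noteq> k" "i < n" "j < n" "k < n"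
    using assms(1-9) block_unique[of P Q i] block_unique[of P R i] block_unique[of Q R j]
      blocks_subset[of P] blocks_subset[of Q] blocks_subset[of R] by auto
  obtain B where B: "{i, j, k} \<subseteq> B" "B \<subseteq> {..<n}" "card B \<le> 3" "free_cols M B"
    using config_extend[OF independent_3[OF assms]] .
  then have "B = {i, j, k}"
    using ijk card_seteq[of B "{i, j, k}"] finite_subset[of B "{..<n}"] by simp
  then show ?thesis
    using B free_cols_3[OF config_carrier, of i j k] ijk by simp
qed

text \<open>The cross product of two columns from distinct blocks on the line: it is nonzero because
  such columns are not parallel, and collinearity makes it orthogonal to all other points of the
  line.\<close>

lemma config_line_form:
  assumes "l \<in> lines L"
  shows "\<exists>h. h \<noteq> vzero \<and> (\<forall>P j. l \<in> through P \<and> j \<in> P \<longrightarrow> vdot h (mcol M j) = 0)"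
proof -
  obtain P Q where PQ: "P \<noteq> Q" "l \<in> through P" "l \<in> through Q"
    using line_two_points[OF assms] .
  have blk: "P \<in> blocks L" "Q \<in> blocks L"
    using PQ through_block by blast+
  obtain i k where ik: "i \<in> P" "k \<in> Q"
    using blk[THEN block_nonempty] by (meson ex_in_conv)
  let ?h = "vcross (mcol M i) (mcol M k)"
  have "vdot ?h (mcol M j) = 0" if R: "l \<in> through R" "j \<in> R" for R j
  proof (cases "j = i \<or> j = k")
    case True
    then show ?thesis
      by (auto simp: vdot_commute[of ?h] vdot_vcross)
  next
    case False
    have "i \<noteq> k"
      using ik blk PQ(1) block_unique[of P Q i] by auto
    moreover have "collinear L {i, k, j}"
      using collinear_iff[OF blk through_block[OF R(1)] ik R(2)] PQ R by blast
    ultimately have "vdet (mcol M i) (mcol M k) (mcol M j) = 0"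
      using M False by (simp add: config_space_iff[OF arrangement])
    then show ?thesis
      by (simp add: vdet_triple)
  qed
  then show ?thesis
    using config_nonparallel[OF blk PQ(1) ik] by blast
qed

text \<open>If the equations were proportional, a point of \<open>m\<close> off \<open>l\<close>
  would depend linearly on two points of \<open>l\<close>, although no line of the arrangement
  contains all three.\<close>

lemma config_lines_nonparallel:
  assumes "l \<in> lines L" "m \<in> lines L" "l \<noteq> m" "h \<noteq> vzero" "h' \<noteq> vzero"
    and h: "\<And>P j. l \<in> through P \<Longrightarrow> j \<in> P \<Longrightarrow> vdot h (mcol M j) = 0"
    and h': "\<And>P j. m \<in> through P \<Longrightarrow> j \<in> P \<Longrightarrow> vdot h' (mcol M j) = 0"
  shows "vcross h h' \<noteq> vzero"
proof
  assume "vcross h h' = vzero"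
  then have "vcross h' h = vzero"
    by (simp add: vcross_swap_eq_zero)
  then obtain s where s: "h = vscale s h'"
    using vcross_zero_imp_vscale assms(5) by blast
  obtain P Q where PQ: "P \<noteq> Q" "l \<in> through P" "l \<in> through Q"
    using line_two_points[OF assms(1)] .
  obtain R where R: "m \<in> through R" "l \<notin> through R"
    using line_not_contained[OF assms(2), of l] assms(3) by metis
  have blk: "P \<in> blocks L" "Q \<in> blocks L" "R \<in> blocks L"
    using PQ R through_block by blast+
  obtain i j k where ijk: "i \<in> P" "j \<in> Q" "k \<in> R"
    using blk[THEN block_nonempty] by (meson ex_in_conv)
  have "vdot h (mcol M k) = 0"
    using h'[OF R(1) ijk(3)] by (metis s vdot_commute vdot_vscale mult_zero_right)
  then have "vdet (mcol M i) (mcol M j) (mcol M k) = 0"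
    using h PQ ijk by (intro ortho_triple_vdet[OF assms(4)]) blast+
  moreover have "through P \<inter> through Q \<inter> through R = {}"
    using PQ R two_points_one_line by blast
  moreover have "P \<noteq> R" "Q \<noteq> R"
    using PQ R by blast+
  ultimately show False
    using config_noncollinear[OF blk PQ(1) _ _ ijk] by blast
qed

end

lemma line_form_cong:
  "(\<And>i. x (Centre i) = y (Centre i)) \<Longrightarrow> (\<And>i. x (Line l i) = y (Line l i)) \<Longrightarrow>
    line_form x l = line_form y l"
  by (simp add: line_form_def pvec_def)

text \<open>Permits changing the scales, or the coordinates of one point, without disturbing the
  other points.\<close>

lemma point_vec_cong:
  fixes x y :: "'l param \<Rightarrow> 'k::comm_ring_1"
  assumes "\<And>i. x (Centre i) = y (Centre i)" "\<And>l i. x (Line l i) = y (Line l i)"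
    "\<And>i. x (Point P i) = y (Point P i)"
  shows "point_vec x P = point_vec y P"
proof -
  have "line_form x = line_form y"
    using assms by (intro ext line_form_cong) auto
  then show ?thesis
    by (simp add: point_vec_def pvec_def assms)
qed

lemma config_space_realized:
  fixes M :: "'k::field mat"
  assumes M: "M \<in> config_space n L"
  shows "\<exists>x. M = realize x"
proof -
  note nonzero = config_nonzero[OF M]
  obtain h where h: "\<And>l. l \<in> lines L \<Longrightarrow> h l \<noteq> vzero"
    "\<And>l P j. l \<in> lines L \<Longrightarrow> l \<in> through P \<Longrightarrow> j \<in> P \<Longrightarrow> vdot (h l) (mcol M j) = 0"
    using config_line_form[OF M] by metis
  define w where "w P = mcol M (SOME j. j \<in> P)" for P
  have rep: "(SOME j. j \<in> P) \<in> P" if "P \<in> blocks L" for P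
    using block_nonempty[OF that] by (simp add: some_in_eq)
  have w: "w P \<noteq> vzero" "\<And>l. l \<in> through P \<Longrightarrow> vdot (h l) (w P) = 0" if "P \<in> blocks L" for P
    using nonzero[OF that rep[OF that]] h(2)[OF through_line _ rep[OF that]] by (simp_all add: w_def)
  \<comment> \<open>At most one block is multiple, so one vector serves; without such a block it is
    arbitrary.\<close>
  obtain p where p: "\<And>P. multiple P \<Longrightarrow> p = w P"
    using multiple_unique by metis
  have "\<exists>u. h l = (if pencil l then vcross p u else u)" if l: "l \<in> lines L" for l
  proof (cases "pencil l")
    case True
    then obtain P where P: "multiple P" "l \<in> through P"
      by (auto simp: pencil_def)
    then have "p \<noteq> vzero" "vdot p (h l) = 0"
      using w[OF multiple_block] p by (metis vdot_commute)+
    then have "\<exists>u. h l = vcross p u"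
      by (rule nonzero_ortho_is_vcross)
    then show ?thesis
      using True by simp
  next
    case False
    then show ?thesis
      by (intro exI[of _ "h l"]) simp
  qed
  then obtain U where U: "\<And>l. l \<in> lines L \<Longrightarrow> h l = (if pencil l then vcross p (U l) else U l)"
    by metis
  \<comment> \<open>Only points on at most one line have coordinates of their own; a point on one
    line is orthogonal to its equation, hence a cross product with it.\<close>
  have "\<exists>v. (through P = {} \<longrightarrow> w P = v) \<and> (\<forall>l. through P = {l} \<longrightarrow> w P = vcross (h l) v)"
    if P: "P \<in> blocks L" for P
  proof (cases "\<exists>l. through P = {l}")
    case True
    then obtain l where l: "through P = {l}"
      by blast
    then have "l \<in> lines L"
      using through_subset by blast
    then have "\<exists>v. w P = vcross (h l) v"
      using l w[OF P] h by (intro nonzero_ortho_is_vcross) auto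
    then show ?thesis
      using l by auto
  next
    case False
    then show ?thesis
      by (intro exI[of _ "w P"]) auto
  qed
  then obtain V where V: "\<And>P. P \<in> blocks L \<Longrightarrow> through P = {} \<Longrightarrow> w P = V P"
    "\<And>P l. P \<in> blocks L \<Longrightarrow> through P = {l} \<Longrightarrow> w P = vcross (h l) (V P)"
    by metis
  \<comment> \<open>The scales are set to 0 provisionally: they can be read off only after the point
    vectors are known.\<close>
  define y :: "'l param \<Rightarrow> 'k" where "y q =
    (case q of Centre i \<Rightarrow> comp3 p i | Line l i \<Rightarrow> comp3 (U l) i | Point P i \<Rightarrow> comp3 (V P) i
      | Scale j \<Rightarrow> 0)" for q
  have y: "pvec Centre y = p" "pvec (Line l) y = U l" "pvec (Point P) y = V P" for l P
    by (rule pvec_comp3, simp add: y_def)+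
  have yl: "line_form y l = h l" if "l \<in> lines L" for l
    using U[OF that] by (simp add: line_form_def y)
  have "\<exists>s. mcol M j = vscale s (point_vec y P)" if P: "P \<in> blocks L" and j: "j \<in> P" for P j
  proof -
    have par: "vcross (w P) (mcol M j) = vzero"
      using M rep[OF P] P j by (simp add: w_def config_space_iff[OF arrangement])
    have "point_vec y P \<noteq> vzero \<and> vcross (point_vec y P) (mcol M j) = vzero"
    proof (cases P rule: point_cases[where 'k='k])
      case free
      then show ?thesis
        using w[OF P] par V(1)[OF P] by (simp add: y)
    next
      case (simple l)
      then have "l \<in> lines L"
        using through_subset by blast
      then show ?thesis
        using simple w[OF P] par V(2)[OF P] by (simp add: y yl)
    next
      case (double l m)
      then have "l \<in> lines L" "m \<in> lines L"
        using through_subset by blast+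
      \<comment> \<open>A double point has no free coordinates. Its column is orthogonal to both
        equations, hence parallel to their nonzero cross product.\<close>
      moreover have "vdot (h l) (mcol M j) = 0" "vdot (h m) (mcol M j) = 0"
        using calculation double(1) h(2)[of l P j] h(2)[of m P j] j by simp_all
      ultimately show ?thesis
        using double h[of l] h[of m]
        by (simp add: yl config_lines_nonparallel[OF M, of l m] vcross_vcross_ortho)
    next
      case multiple
      then show ?thesis
        using w[OF P] par p by (simp add: y)
    qed
    then show ?thesis
      using vcross_zero_imp_vscale by blast
  qed
  then obtain s where s: "\<And>P j. P \<in> blocks L \<Longrightarrow> j \<in> P \<Longrightarrow> mcol M j = vscale (s P j) (point_vec y P)"
    by metis
  define x where "x q = (case q of Scale j \<Rightarrow> s (block_of j) j | _ \<Rightarrow> y q)" for q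
  have "point_vec x P = point_vec y P" for P
    by (rule point_vec_cong) (simp_all add: x_def)
  then have col: "mcol (realize x) j = mcol M j" if "P \<in> blocks L" "j \<in> P" for P j
    using s[OF that] that by (simp add: mcol_realize_block x_def block_of_eq)
  have "mcol (realize x) j = mcol M j" if "j < n" for j
  proof (cases "j \<in> zeros L")
    case True
    then show ?thesis
      using M by (simp add: realize_relations(1) config_space_iff[OF arrangement])
  next
    case False
    then show ?thesis
      using block_ex[OF that] col by blast
  qed
  then have "realize x = M"
    by (rule mat_eqI_mcol[OF realize_carrier config_carrier[OF M]])
  then show ?thesis
    by blast
qed

end

section \<open>A generic parameter yields a configuration\<close>

context few_lines
begin

definition set_point ::
  "('l param \<Rightarrow> 'k::comm_ring_1) \<Rightarrow> nat set \<Rightarrow> 'k \<times> 'k \<times> 'k \<Rightarrow> 'l param \<Rightarrow> 'k" where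
  "set_point x P v q = (case q of Point Q i \<Rightarrow> if Q = P then comp3 v i else x q | _ \<Rightarrow> x q)"

lemma pvec_set_point [simp]: "pvec (Point P) (set_point x P v) = v"
  by (rule pvec_comp3) (simp add: set_point_def)

lemma line_form_set_point [simp]: "line_form (set_point x P v) l = line_form x l"
  by (rule line_form_cong) (simp_all add: set_point_def)

lemma point_vec_set_point: "Q \<noteq> P \<Longrightarrow> point_vec (set_point x P v) Q = point_vec x Q"
  by (rule point_vec_cong) (simp_all add: set_point_def)

text \<open>General position up to the one forced concurrency: lines of the pencil meet in the
  centre, and no other three lines are concurrent.\<close>

definition general_lines :: "('l param \<Rightarrow> 'k::comm_ring_1) \<Rightarrow> bool" where
  "general_lines x \<longleftrightarrow> pvec Centre x \<noteq> vzero \<and>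
     (\<forall>l. line_form x l \<noteq> vzero) \<and>
     (\<forall>l P. multiple P \<and> \<not> pencil l \<longrightarrow> vdot (line_form x l) (pvec Centre x) \<noteq> 0) \<and>
     (\<forall>l\<in>lines L. \<forall>m\<in>lines L. l \<noteq> m \<longrightarrow> vcross (line_form x l) (line_form x m) \<noteq> vzero) \<and>
     (\<forall>l\<in>lines L. \<forall>m\<in>lines L. \<forall>k\<in>lines L.
        l \<noteq> m \<and> l \<noteq> k \<and> m \<noteq> k \<and> \<not> (pencil l \<and> pencil m \<and> pencil k) \<longrightarrow>
        vdet (line_form x l) (line_form x m) (line_form x k) \<noteq> 0)"

text \<open>Three lines that do not all belong to the pencil are put in general position: the lines of the
  pencil get the forms \<open>(1, c, 0)\<close> and the remaining one \<open>(0, 0, 1)\<close>; without a multiple point the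
  lines are taken on the moment curve.\<close>

lemma ex_general_lines: "\<exists>x :: 'l param \<Rightarrow> 'k::alg_closed_field. general_lines x"
proof -
  obtain A :: "'k set" where "finite A" "card A = card (lines L)"
    using infinite_arbitrarily_large[OF infinite_alg_closed_field] by metis
  then obtain c :: "'l \<Rightarrow> 'k" where "bij_betw c (lines L) A"
    using finite_same_card_bij[OF finite_lines] by metis
  then have c: "c l \<noteq> c m" if "l \<in> lines L" "m \<in> lines L" "l \<noteq> m" for l m
    using that by (auto simp: bij_betw_def inj_on_def)
  \<comment> \<open>With centre (0, 0, 1), the cross product with (c, -1, 0) is (1, c, 0).\<close>
  define u where "u l = (if pencil l then (c l, - 1, 0)
    else if \<exists>P. multiple P then (0, 0, 1) else (1, c l, c l * c l))" for l
  define x :: "'l param \<Rightarrow> 'k" where "x q =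
    (case q of Centre i \<Rightarrow> comp3 (0, 0, 1) i | Line l i \<Rightarrow> comp3 (u l) i | _ \<Rightarrow> 0)" for q
  have x: "pvec Centre x = (0, 0, 1)" "pvec (Line l) x = u l" for l
    by (rule pvec_comp3, simp add: x_def)+
  then have lf: "line_form x l = (if pencil l then (1, c l, 0)
      else if \<exists>P. multiple P then (0, 0, 1) else (1, c l, c l * c l))" for l
    by (simp add: line_form_def u_def)
  show ?thesis
    unfolding general_lines_def
  proof (intro exI[of _ x] conjI allI ballI impI, goal_cases)
    case 1
    then show ?case
      by (simp add: x)
  next
    case (2 l)
    then show ?case
      by (simp add: lf)
  next
    case (3 l P)
    then show ?case
      by (auto simp: lf x)
  next
    case (4 l m)
    then show ?case
      using c[OF 4] one_line_off_pencil[of _ l m] by (auto simp: lf)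
  next
    case (5 l m k)
    show ?case
    proof (cases "\<exists>P. multiple P")
      case True
      \<comment> \<open>At most one line avoids the centre, so exactly two of the three are in the
        pencil, and the determinant is up to sign a difference of two values of
        \<open>c\<close>.\<close>
      then have "pencil l \<or> pencil m" "pencil l \<or> pencil k" "pencil m \<or> pencil k"
        using 5 one_line_off_pencil by blast+
      then show ?thesis
        using True 5 c[of l m] c[of l k] c[of m k] by (auto simp: lf vdet_def)
    next
      case False
      then have "line_form x l' = (1, c l', c l' * c l')" for l'
        by (auto simp: lf pencil_def)
      \<comment> \<open>The Vandermonde determinant.\<close>
      then have "vdet (line_form x l) (line_form x m) (line_form x k) =
          (c m - c l) * (c k - c l) * (c k - c m)"
        by (simp add: vdet_def algebra_simps)
      then show ?thesis
        using 5 c[of m l] c[of k l] c[of k m] by auto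
    qed
  qed
qed

text \<open>The base position for the perturbations: nothing degenerates, and a point lies on a line
  only if the arrangement says so.\<close>

definition general :: "('l param \<Rightarrow> 'k::comm_ring_1) \<Rightarrow> bool" where
  "general x \<longleftrightarrow> (\<forall>l\<in>lines L. line_form x l \<noteq> vzero) \<and> (\<forall>P\<in>blocks L. point_vec x P \<noteq> vzero) \<and>
     (\<forall>P\<in>blocks L. \<forall>l\<in>lines L - through P. vdot (line_form x l) (point_vec x P) \<noteq> 0)"

lemma ex_point_vec_nonzero: "\<exists>x :: 'l param \<Rightarrow> 'k::alg_closed_field. point_vec x P \<noteq> vzero"
proof -
  obtain x :: "'l param \<Rightarrow> 'k" where "general_lines x"
    using ex_general_lines by blast
  then have x: "pvec Centre x \<noteq> vzero" "line_form x l \<noteq> vzero"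
    "l \<in> lines L \<Longrightarrow> m \<in> lines L \<Longrightarrow> l \<noteq> m \<Longrightarrow> vcross (line_form x l) (line_form x m) \<noteq> vzero" for l m
    by (auto simp: general_lines_def)
  show ?thesis
  proof (cases P rule: point_cases[where 'k='k])
    case free
    then show ?thesis
      by (intro exI[of _ "set_point x P (1, 0, 0)"]) simp
  next
    case (simple l)
    obtain u where "vcross (vcross (line_form x l) u) (line_form x l) \<noteq> vzero"
      using ex_vcross_nonparallel[OF x(2) x(2)] by blast
    then have "vcross (line_form x l) u \<noteq> vzero"
      by auto
    then show ?thesis
      using simple by (intro exI[of _ "set_point x P u"]) simp
  next
    case (double l m)
    then have "l \<in> lines L" "m \<in> lines L"
      using through_subset by blast+
    then show ?thesis
      using double x(3) by (intro exI[of _ x]) simp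
  next
    case multiple
    then show ?thesis
      using x(1) by (intro exI[of _ x]) simp
  qed
qed

lemma ex_point_off_line:
  assumes l: "l \<in> lines L" "l \<notin> through P"
  shows "\<exists>x :: 'l param \<Rightarrow> 'k::alg_closed_field. vdot (line_form x l) (point_vec x P) \<noteq> 0"
proof -
  obtain x :: "'l param \<Rightarrow> 'k" where gen: "general_lines x"
    using ex_general_lines by blast
  show ?thesis
  proof (cases P rule: point_cases[where 'k='k])
    case free
    have "line_form x l \<noteq> vzero"
      using gen by (simp add: general_lines_def)
    then obtain v where "vdot (line_form x l) v \<noteq> 0"
      using vdot_all_zero by blast
    then show ?thesis
      using free by (intro exI[of _ "set_point x P v"]) simp
  next
    case (simple m)
    then have "m \<in> lines L" "l \<noteq> m"
      using through_subset l by blast+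
    then have "vcross (line_form x l) (line_form x m) \<noteq> vzero"
      using gen l(1) by (simp add: general_lines_def)
    then obtain v where "vdot (vcross (line_form x l) (line_form x m)) v \<noteq> 0"
      using vdot_all_zero by blast
    then show ?thesis
      using simple by (intro exI[of _ "set_point x P v"]) (simp add: vdot_vcross_move)
  next
    case (double m k)
    then have mk: "m \<in> lines L" "k \<in> lines L" "l \<noteq> m" "l \<noteq> k"
      using through_subset l by blast+
    \<comment> \<open>Otherwise \<open>m\<close> and \<open>k\<close> would both join
      \<open>P\<close> to the centre, which differs from \<open>P\<close> because it lies on
      \<open>l\<close>.\<close>
    have "\<not> (pencil l \<and> pencil m \<and> pencil k)"
    proof
      assume pen: "pencil l \<and> pencil m \<and> pencil k"
      then obtain Q where Q: "multiple Q" "l \<in> through Q"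
        by (auto simp: pencil_def)
      then have "m \<in> through Q" "k \<in> through Q"
        using pen mk through_multiple by blast+
      moreover have "P \<noteq> Q"
        using Q(2) l(2) by blast
      ultimately show False
        using two_points_one_line[of P Q m k] double by simp
    qed
    then have "vdet (line_form x l) (line_form x m) (line_form x k) \<noteq> 0"
      using gen l(1) mk double(2) by (simp add: general_lines_def)
    then show ?thesis
      using double by (intro exI[of _ x]) (simp add: vdet_def)
  next
    case multiple
    then have "\<not> pencil l"
      using l through_multiple by blast
    then show ?thesis
      using multiple gen by (intro exI[of _ x]) (auto simp: general_lines_def)
  qed
qed

lemma generically_general: "generically (general :: ('l param \<Rightarrow> 'k::alg_closed_field) \<Rightarrow> bool)"
proof -
  obtain x :: "'l param \<Rightarrow> 'k" where x: "\<And>l. line_form x l \<noteq> vzero"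
    using ex_general_lines unfolding general_lines_def by blast
  have "generically (\<lambda>x :: 'l param \<Rightarrow> 'k. \<forall>l\<in>lines L. line_form x l \<noteq> vzero)"
    by (rule generically_ball[OF finite_lines], rule generically_nonzero_vec[OF linepoly_line_form x])
  moreover have "generically (\<lambda>x :: 'l param \<Rightarrow> 'k. \<forall>P\<in>blocks L. point_vec x P \<noteq> vzero)"
  proof (rule generically_ball[OF finite_blocks])
    fix P
    obtain x :: "'l param \<Rightarrow> 'k" where "point_vec x P \<noteq> vzero"
      using ex_point_vec_nonzero by blast
    then show "generically (\<lambda>x :: 'l param \<Rightarrow> 'k. point_vec x P \<noteq> vzero)"
      by (rule generically_nonzero_vec[OF linepoly_point_vec])
  qed
  moreover have "generically (\<lambda>x :: 'l param \<Rightarrow> 'k. \<forall>P\<in>blocks L. \<forall>l\<in>lines L - through P.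
      vdot (line_form x l) (point_vec x P) \<noteq> 0)"
  proof (rule generically_ball[OF finite_blocks], rule generically_ball)
    fix P l
    assume "l \<in> lines L - through P"
    then obtain x :: "'l param \<Rightarrow> 'k" where "vdot (line_form x l) (point_vec x P) \<noteq> 0"
      using ex_point_off_line by blast
    then show "generically (\<lambda>x :: 'l param \<Rightarrow> 'k. vdot (line_form x l) (point_vec x P) \<noteq> 0)"
      by (intro generically_nonzero[where x=x] linepoly_vdot linepoly_line_form linepoly_point_vec)
  qed (use finite_lines in simp)
  ultimately show ?thesis
    unfolding general_def[abs_def] by (intro generically_conj)
qed

section \<open>Separating pairs and triples of points\<close>

lemma movable_cases:
  assumes "card (through P) \<le> 1"
  obtains
    (free) "through P = {}" "\<And>x :: 'l param \<Rightarrow> 'k::comm_ring_1. point_vec x P = pvec (Point P) x"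
  | (simple) l where "through P = {l}"
      "\<And>x :: 'l param \<Rightarrow> 'k. point_vec x P = vcross (line_form x l) (pvec (Point P) x)"
  by (cases P rule: point_cases[where 'k='k]) (use assms in \<open>auto simp: multiple_def\<close>)

text \<open>A free point ranges over the whole space and a point on one line over a plane; neither
  is contained in the span of \<open>w\<close>.\<close>

lemma move_off_point:
  fixes x :: "'l param \<Rightarrow> 'k::alg_closed_field"
  assumes x: "general x" and P: "card (through P) \<le> 1" and w: "w \<noteq> vzero"
  shows "\<exists>v. vcross (point_vec (set_point x P v) P) w \<noteq> vzero"
  using P
proof (cases rule: movable_cases[where 'k='k])
  case free
  then show ?thesis
    using ex_vcross_nonparallel[OF w w] by (metis pvec_set_point)
next
  case (simple l)
  then have "line_form x l \<noteq> vzero"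
    using x through_subset[of P] by (auto simp: general_def)
  then show ?thesis
    using ex_vcross_nonparallel[OF _ w] simple(2) by (metis pvec_set_point line_form_set_point)
qed

lemma generically_nonparallel:
  assumes PQ: "P \<in> blocks L" "Q \<in> blocks L" "P \<noteq> Q"
  shows "generically (\<lambda>x :: 'l param \<Rightarrow> 'k::alg_closed_field.
    vcross (point_vec x P) (point_vec x Q) \<noteq> vzero)"
proof -
  obtain x :: "'l param \<Rightarrow> 'k" where x: "general x"
    using generically_ex[OF generically_general] by blast
  then have nz: "point_vec x P \<noteq> vzero" "point_vec x Q \<noteq> vzero"
    using PQ by (auto simp: general_def)
  have "\<exists>x :: 'l param \<Rightarrow> 'k. vcross (point_vec x P) (point_vec x Q) \<noteq> vzero"
  proof -
    consider "card (through P) \<le> 1" | "card (through Q) \<le> 1" | "card (through P) \<ge> 2"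
      by linarith
    then show ?thesis
    proof cases
      case 1
      then show ?thesis
        using move_off_point[OF x _ nz(2)] point_vec_set_point[of Q P] PQ(3) by metis
    next
      case 2
      then show ?thesis
        using move_off_point[OF x _ nz(1)] point_vec_set_point[of P Q] PQ(3)
        by (metis vcross_swap_eq_zero)
    next
      case 3
      then have "\<not> card (through P) \<le> Suc 0"
        by simp
      then obtain l m where "l \<in> through P" "m \<in> through P" "l \<noteq> m"
        using finite_through by (auto simp: card_le_Suc0_iff_eq)
      \<comment> \<open>Distinct points share at most one line, so one of two lines through
        \<open>P\<close> misses \<open>Q\<close>. Its equation vanishes at \<open>P\<close> but not
        at \<open>Q\<close>, which separates the two vectors.\<close>
      then obtain m where m: "m \<in> through P" "m \<notin> through Q"
        using two_points_one_line[OF PQ(3)] by blast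
      then have "vdot (line_form x m) (point_vec x Q) \<noteq> 0"
        using x PQ(2) through_line by (auto simp: general_def)
      then have "vcross (point_vec x P) (point_vec x Q) \<noteq> vzero"
        using vcross_zero_imp_vscale[OF nz(1)] point_on_line[OF m(1), of x]
        by (metis vdot_vscale mult_zero_right)
      then show ?thesis
        by blast
    qed
  qed
  then obtain y :: "'l param \<Rightarrow> 'k" where "vcross (point_vec y P) (point_vec y Q) \<noteq> vzero"
    by blast
  then show ?thesis
    by (intro generically_nonzero_vec[where x=y] linepoly_vcross linepoly_point_vec)
qed

text \<open>Either \<open>P\<close> can be moved out of the plane spanned by \<open>Q\<close> and
  \<open>R\<close>, or \<open>P\<close> and \<open>Q\<close> span the plane of a common line, which
  \<open>R\<close> avoids by generality.\<close>

lemma noncollinear_aux: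
  fixes x :: "'l param \<Rightarrow> 'k::alg_closed_field"
  assumes x: "general x" and blk: "P \<in> blocks L" "Q \<in> blocks L" "R \<in> blocks L" "P \<noteq> Q" "P \<noteq> R"
    and empty: "through P \<inter> through Q \<inter> through R = {}"
    and PQ: "vcross (point_vec x P) (point_vec x Q) \<noteq> vzero"
    and QR: "vcross (point_vec x Q) (point_vec x R) \<noteq> vzero"
    and cs: "card (through P) \<le> 1 \<or> through P \<inter> through Q \<noteq> {}"
  shows "\<exists>y :: 'l param \<Rightarrow> 'k. vdet (point_vec y P) (point_vec y Q) (point_vec y R) \<noteq> 0"
  using cs
proof
  assume "card (through P) \<le> 1"
  let ?a = "vcross (point_vec x Q) (point_vec x R)"
  have same: "point_vec (set_point x P v) Q = point_vec x Q" "point_vec (set_point x P v) R = point_vec x R"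
    for v
    using blk by (simp_all add: point_vec_set_point)
  have "\<exists>v. vdot ?a (point_vec (set_point x P v) P) \<noteq> 0"
    using \<open>card (through P) \<le> 1\<close>
  proof (cases rule: movable_cases[where 'k='k])
    case free
    then show ?thesis
      using vdot_all_zero QR by (metis pvec_set_point)
  next
    case (simple l)
    \<comment> \<open>If the only line through \<open>P\<close> had the plane of \<open>Q\<close>
      and \<open>R\<close> as its plane, generality would put both points on that line, and all
      three points would share it.\<close>
    have "vcross ?a (line_form x l) \<noteq> vzero"
    proof
      assume "vcross ?a (line_form x l) = vzero"
      then obtain s where "line_form x l = vscale s ?a"
        using vcross_zero_imp_vscale QR by blast
      then have "vdot (line_form x l) (point_vec x Q) = 0" "vdot (line_form x l) (point_vec x R) = 0"
        by (metis vdot_commute vdot_vscale vdot_vcross mult_zero_right)+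
      then have "l \<in> through Q" "l \<in> through R"
        using x blk simple(1) through_subset[of P] by (auto simp: general_def)
      then show False
        using empty simple(1) by blast
    qed
    then show ?thesis
      using vdot_all_zero simple(2) by (metis vdot_vcross_move pvec_set_point line_form_set_point)
  qed
  then show ?thesis
    using same by (metis vdet_def vdot_commute)
next
  assume "through P \<inter> through Q \<noteq> {}"
  then obtain l where l: "l \<in> through P" "l \<in> through Q"
    by blast
  then have "l \<notin> through R" "l \<in> lines L"
    using empty through_line by blast+
  then have R: "vdot (line_form x l) (point_vec x R) \<noteq> 0"
    using x blk by (auto simp: general_def)
  have "vcross (vcross (point_vec x P) (point_vec x Q)) (line_form x l) = vzero"
    by (intro vcross_vcross_ortho) (metis vdot_commute point_on_line l)+
  then obtain s where "line_form x l = vscale s (vcross (point_vec x P) (point_vec x Q))"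
    using vcross_zero_imp_vscale PQ by blast
  then have "vdet (point_vec x P) (point_vec x Q) (point_vec x R) \<noteq> 0"
    using R by (metis vdet_triple vdot_commute vdot_vscale mult_zero_right)
  then show ?thesis
    by blast
qed

lemma ex_noncollinear:
  assumes blk: "P \<in> blocks L" "Q \<in> blocks L" "R \<in> blocks L" "P \<noteq> Q" "P \<noteq> R" "Q \<noteq> R"
    and empty: "through P \<inter> through Q \<inter> through R = {}"
  shows "\<exists>x :: 'l param \<Rightarrow> 'k::alg_closed_field.
    vdet (point_vec x P) (point_vec x Q) (point_vec x R) \<noteq> 0"
proof -
  have "generically (\<lambda>x :: 'l param \<Rightarrow> 'k. general x \<and>
      vcross (point_vec x P) (point_vec x Q) \<noteq> vzero \<and>
      vcross (point_vec x Q) (point_vec x R) \<noteq> vzero \<and>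
      vcross (point_vec x R) (point_vec x P) \<noteq> vzero)"
    using blk by (intro generically_conj generically_general generically_nonparallel) auto
  then obtain x :: "'l param \<Rightarrow> 'k" where x: "general x"
    "vcross (point_vec x P) (point_vec x Q) \<noteq> vzero"
    "vcross (point_vec x Q) (point_vec x R) \<noteq> vzero"
    "vcross (point_vec x R) (point_vec x P) \<noteq> vzero"
    using generically_ex by blast
  \<comment> \<open>Otherwise three pairwise disjoint sets of at least two lines each would give six
    lines.\<close>
  have "card (through P) \<le> 1 \<or> card (through Q) \<le> 1 \<or> card (through R) \<le> 1 \<or>
      through P \<inter> through Q \<noteq> {} \<or> through Q \<inter> through R \<noteq> {} \<or> through R \<inter> through P \<noteq> {}"
  proof (rule ccontr)
    assume neg: "\<not> ?thesis"
    then have "card (through P \<union> through Q \<union> through R) =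
        card (through P) + card (through Q) + card (through R)"
      by (subst card_Un_disjoint, (auto simp: finite_through)[3])
        (subst card_Un_disjoint, auto simp: finite_through)
    moreover have "card (through P \<union> through Q \<union> through R) \<le> 4"
      using card_mono[OF finite_lines, of "through P \<union> through Q \<union> through R"] through_subset card_lines
      by (meson Un_least le_trans)
    ultimately show False
      using neg by linarith
  qed
  then consider "card (through P) \<le> 1 \<or> through P \<inter> through Q \<noteq> {}"
    | "card (through Q) \<le> 1 \<or> through Q \<inter> through R \<noteq> {}"
    | "card (through R) \<le> 1 \<or> through R \<inter> through P \<noteq> {}"
    by blast
  then show ?thesis
  proof cases
    case 1
    then show ?thesis
      using noncollinear_aux[OF x(1) blk(1,2,3,4,5) empty x(2,3)] by blast
  next
    case 2
    have "through Q \<inter> through R \<inter> through P = {}"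
      using empty by blast
    then obtain y :: "'l param \<Rightarrow> 'k" where "vdet (point_vec y Q) (point_vec y R) (point_vec y P) \<noteq> 0"
      using noncollinear_aux[OF x(1) blk(2,3,1,6) _ _ x(3,4)] 2 blk(4) by blast
    then show ?thesis
      using vdet_rotate by metis
  next
    case 3
    have "through R \<inter> through P \<inter> through Q = {}"
      using empty by blast
    then obtain y :: "'l param \<Rightarrow> 'k" where "vdet (point_vec y R) (point_vec y P) (point_vec y Q) \<noteq> 0"
      using noncollinear_aux[OF x(1) blk(3,1,2) _ _ _ x(4,2)] 3 blk(5,6) by blast
    then show ?thesis
      using vdet_rotate by metis
  qed
qed

section \<open>From point vectors to bases and the configuration space\<close>

definition unscale :: "('l param \<Rightarrow> 'k::comm_ring_1) \<Rightarrow> 'l param \<Rightarrow> 'k" where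
  "unscale x q = (case q of Scale j \<Rightarrow> 1 | _ \<Rightarrow> x q)"

lemma mcol_realize_unscale:
  assumes "P \<in> blocks L" "j \<in> P"
  shows "mcol (realize (unscale x)) j = point_vec x P"
proof -
  have "point_vec (unscale x) P = point_vec x P"
    by (rule point_vec_cong) (simp_all add: unscale_def)
  then show ?thesis
    using assms by (cases "point_vec x P") (simp add: mcol_realize_block unscale_def)
qed

lemma ex_free_cols_realize:
  assumes B: "independent n L B"
  shows "\<exists>x :: 'l param \<Rightarrow> 'k::alg_closed_field. free_cols (realize x) B"
proof -
  have fin: "finite B" and sub: "B \<subseteq> {..<n}" and "card B \<le> 3"
    using B by (auto simp: independent_def intro: finite_subset)
  have blk: "\<exists>P\<in>blocks L. i \<in> P" if "i \<in> B" for i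
    using that B block_ex by (auto simp: independent_def)
  have nc: "P \<noteq> Q" if "i \<in> B" "j \<in> B" "i \<noteq> j" "i \<in> P" "j \<in> Q" "P \<in> blocks L" for i j P Q
  proof -
    have "\<not> coincide L i j"
      using that(1-3) B unfolding independent_def by blast
    then show ?thesis
      using that(4-6) unfolding coincide_def by blast
  qed
  have "card B = 0 \<or> card B = 1 \<or> card B = 2 \<or> card B = 3"
    using \<open>card B \<le> 3\<close> by linarith
  then consider "B = {}" | i where "B = {i}" | i j where "B = {i, j}" "i \<noteq> j"
    | i j k where "B = {i, j, k}" "i \<noteq> j" "i \<noteq> k" "j \<noteq> k"
    using fin by (auto simp: card_1_singleton_iff card_2_iff card_3_iff)
  then show ?thesis
  proof cases
    case 1
    then show ?thesis
      by (simp add: free_cols_empty)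
  next
    case (2 i)
    then obtain P where P: "P \<in> blocks L" "i \<in> P"
      using blk by blast
    obtain x :: "'l param \<Rightarrow> 'k" where "point_vec x P \<noteq> vzero"
      using ex_point_vec_nonzero by blast
    then have "free_cols (realize (unscale x)) {i}"
      using 2 sub by (subst free_cols_1[OF realize_carrier]) (auto simp: mcol_realize_unscale[OF P])
    then show ?thesis
      using 2 by blast
  next
    case (3 i j)
    then obtain P Q where PQ: "P \<in> blocks L" "i \<in> P" "Q \<in> blocks L" "j \<in> Q"
      using blk by (meson insertI1 insertI2)
    then have "P \<noteq> Q"
      using nc[of i j P Q] 3 by blast
    then obtain x :: "'l param \<Rightarrow> 'k" where "vcross (point_vec x P) (point_vec x Q) \<noteq> vzero"
      using generically_ex[OF generically_nonparallel] PQ by blast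
    then have "free_cols (realize (unscale x)) {i, j}"
      using 3 sub by (subst free_cols_2[OF realize_carrier])
        (auto simp: mcol_realize_unscale[OF PQ(1,2)] mcol_realize_unscale[OF PQ(3,4)])
    then show ?thesis
      using 3 by blast
  next
    case (4 i j k)
    then obtain P Q R where PQR: "P \<in> blocks L" "i \<in> P" "Q \<in> blocks L" "j \<in> Q" "R \<in> blocks L" "k \<in> R"
      using blk by (meson insertI1 insertI2)
    then have ne: "P \<noteq> Q" "P \<noteq> R" "Q \<noteq> R"
      using nc[of i j P Q] nc[of i k P R] nc[of j k Q R] 4 by blast+
    have "card {i, j, k} = 3"
      using 4 by simp
    then have "\<not> collinear L {i, j, k}"
      using B 4(1) unfolding independent_def by blast
    then have "through P \<inter> through Q \<inter> through R = {}"
      using collinear_iff[OF PQR(1,3,5,2,4,6)] by blast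
    then obtain x :: "'l param \<Rightarrow> 'k" where
      "vdet (point_vec x P) (point_vec x Q) (point_vec x R) \<noteq> 0"
      using ex_noncollinear[OF PQR(1,3,5) ne] by blast
    then have "free_cols (realize (unscale x)) {i, j, k}"
      using 4 sub by (subst free_cols_3[OF realize_carrier])
        (auto simp: mcol_realize_unscale[OF PQR(1,2)] mcol_realize_unscale[OF PQR(3,4)]
          mcol_realize_unscale[OF PQR(5,6)])
    then show ?thesis
      using 4 by blast
  qed
qed

lemma generically_config_space:
  "generically (\<lambda>x :: 'l param \<Rightarrow> 'k::alg_closed_field. realize x \<in> config_space n L)"
proof -
  have "finite {B. is_basis n L B}"
    by (rule finite_subset[of _ "Pow {..<n}"]) (auto simp: is_basis_def independent_def)
  then have "generically (\<lambda>x :: 'l param \<Rightarrow> 'k. \<forall>B\<in>{B. is_basis n L B}. free_cols (realize x) B)"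
  proof (rule generically_ball)
    fix B assume "B \<in> {B. is_basis n L B}"
    then have B: "independent n L B"
      by (simp add: is_basis_def)
    obtain x :: "'l param \<Rightarrow> 'k" where "free_cols (realize x) B"
      using ex_free_cols_realize[OF B] by blast
    \<comment> \<open>Independence is a disjunction over row sets. Fixing the minor that is nonzero
      at this parameter leaves a single polynomial condition.\<close>
    then obtain A where A: "A \<subseteq> {..<3}" "card A = card B" "det (submatrix (realize x) A B) \<noteq> 0"
      by (auto simp: free_cols_def)
    have "(minor n A B :: 'k mpoly) \<in> carrier (poly_ring n)"
      using B A by (intro minor_carrier) (auto simp: independent_def)
    moreover have "peval (realize x) (minor n A B) \<noteq> 0"
      using A(3) by (simp add: peval_minor[OF realize_carrier])
    ultimately have "generically (\<lambda>x :: 'l param \<Rightarrow> 'k. peval (realize x) (minor n A B) \<noteq> 0)"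
      by (intro generically_nonzero[where x=x] linepoly_peval_realize)
    then show "generically (\<lambda>x :: 'l param \<Rightarrow> 'k. free_cols (realize x) B)"
      by (rule generically_mono) (use A in \<open>auto simp: peval_minor[OF realize_carrier] free_cols_def\<close>)
  qed
  \<comment> \<open>The relations hold for every parameter, so only the basis conditions had to be
    generic.\<close>
  then show ?thesis
    by (rule generically_mono) (simp add: config_space_iff[OF arrangement] realize_relations)
qed

end

theorem corollary4:
  fixes n :: nat and L :: "'l arrangement"
  assumes "line_arrangement n L"
    and "finite (lines L)" and "card (lines L) \<le> 4"
  shows "zariski_irreducible n (arr_variety n L :: 'k::alg_closed_field mat set) \<and>
         primeideal (arr_ideal n L :: 'k mpoly set) (poly_ring n)"
proof -
  interpret few_lines n L
    using assms by unfold_locales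
  let ?Z = "config_space n L :: 'k mat set"
  note generic = generically_config_space[where 'k='k]
  show ?thesis
    unfolding arr_variety_def arr_ideal_def
  proof (rule irreducible_and_prime)
    show "?Z \<noteq> {}"
      using generically_ex[OF generic] by blast
  next
    fix f g :: "'k mpoly" and M M'
    assume fg: "f \<in> carrier (poly_ring n)" "g \<in> carrier (poly_ring n)"
      and M: "M \<in> ?Z" "M' \<in> ?Z" "peval M f \<noteq> 0" "peval M' g \<noteq> 0"
    obtain x y where "M = realize x" "M' = realize y"
      using config_space_realized M by blast
    \<comment> \<open>Three open conditions: \<open>x\<close> witnesses the one for
      \<open>f\<close>, \<open>y\<close> the one for \<open>g\<close>, and membership in the
      configuration space is generic by itself.\<close>
    then have "generically (\<lambda>x :: 'l param \<Rightarrow> 'k. realize x \<in> ?Z \<and>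
        peval (realize x) f \<noteq> 0 \<and> peval (realize x) g \<noteq> 0)"
      using fg M by (intro generically_conj generic)
        (auto intro!: generically_nonzero linepoly_peval_realize)
    then show "\<exists>N\<in>?Z. peval N f \<noteq> 0 \<and> peval N g \<noteq> 0"
      using generically_ex by blast
  qed
qed

end
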